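(* Let $(\overline M,\overline\varphi,\overline\xi,\overline\eta,\overline g,\overline{\widetilde g})$ be a $(2n+1)$-dimensional $\mathcal F_0$-manifold, let $(M,g)$ be an ascreen radical screen transversal half lightlike submanifold of $(\overline M,\overline g)$, and let $\widetilde g$ be the metric induced on $M$ by the associated metric $\overline{\widetilde g}$. Then the following assertions are equivalent: (i) $(M,\widetilde g)$ is a minimal submanifold of $(\overline M,\overline{\widetilde g})$. (ii) $(M,g)$ is a minimal submanifold of $(\overline M,\overline g)$.
   Context: Almost contact B-metric manifold: a $(2n+1)$-dimensional smooth manifold $\overline M$ with an endomorphism $\overline\varphi$ of $T\overline M$, a vector field $\overline\xi$, a 1-form $\overline\eta$ and a semi-Riemannian metric $\overline g$ such that $\overline\varphi^2X=-X+\overline\eta(X)\overline\xi$, $\overline\eta(\overline\xi)=1$, $\overline g(\overline\varphi X,\overline\varphi Y)=-\overline g(X,Y)+\overline\eta(X)\overline\eta(Y)$. Consequently $\overline\varphi\,\overline\xi=0$, $\overline\eta\circ\overline\varphi=0$, $\overline\eta(X)=\overline g(X,\overline\xi)$, $\overline g(\overline\xi,\overline\xi)=1$. The associated metric is $\overline{\widetilde g}(X,Y)=\overline g(X,\overline\varphi Y)+\overline\eta(X)\overline\eta(Y)$. Both metrics have signature $(n+1,n)$. It is an $\mathcal F_0$-manifold if $\overline g((\overline\nabla_X\overline\varphi)Y,Z)=0$ for all $X,Y,Z$, i.e. $\overline\nabla\,\overline\varphi=0$, where $\overline\nabla$ is the Levi-Civita connection of $\overline g$; then $\overline\nabla$ is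 also the Levi-Civita connection of $\overline{\widetilde g}$. Half lightlike submanifold: a submanifold $M$ of codimension 2 of $(\overline M,\overline g)$, with induced (degenerate) metric $g$, such that ${\rm Rad}(TM)=TM\cap TM^\bot$ has constant rank 1, where $TM^\bot$ is the normal bundle with respect to $\overline g$. One fixes non-degenerate distributions $S(TM)$ (screen distribution) and $S(TM^\bot)$ (screen transversal bundle, of rank 1) with $TM={\rm Rad}(TM)\bot S(TM)$ and $TM^\bot={\rm Rad}(TM)\bot S(TM^\bot)$. Locally, $L$ denotes a unit vector field spanning $S(TM^\bot)$, $\xi$ a nowhere zero section of ${\rm Rad}(TM)$, and $N$ the unique local vector field with $\overline g(N,\xi)=1$, $\overline g(N,N)=\overline g(N,L)=\overline g(N,X)=0$ for all $X\in\Gamma(S(TM))$. The lightlike transversal bundle is ${\rm ltr}(TM)={\rm span}\{N\}$, and $T\overline M|_M=TM\oplus{\rm ltr}(TM)\oplus S(TM^\bot)$. $M$ is a radical screen transversal half lightlike (RSTHL) submanifold if $\overline\varphi({\rm Rad}(TM))=S(TM^\bot)$; it is ascreen if $\overline\xi$ (along $M$) belongs to ${\rm Rad}(TM)\oplus{\rm ltr}(TM)$. For an ascreen RSTHL submanifold, $(M,\widetilde g)$ is a semi-Riemannian (non-degenerate) submanifold of $(\overline M,\overline{\widetilde g})$ of codimension two. Minimality of $(M,g)$: write $\overline\nabla_XY=\nabla_XY+h(X,Y)$ with $\nabla_XY\in\Gamma(TM)$ and second fundamental form $h(X,Y)=B(X,Y)N+D(X,Y)L\in{\rm ltr}(TM)\oplus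 S(TM^\bot)$, and let $h^S(X,Y)=D(X,Y)L$ be its $S(TM^\bot)$-component. $(M,g)$ is minimal if $h^S=0$ on ${\rm Rad}(TM)$ (i.e. $h^S(\xi,\xi)=0$) and ${\rm trace}_{g|_{S(TM)}}h=0$, the trace of $h$ restricted to $S(TM)$ with respect to the non-degenerate metric $g|_{S(TM)}$. Minimality of $(M,\widetilde g)$: ${\rm trace}_{\widetilde g}\widetilde h=0$, where $\widetilde h$ is the second fundamental form of the semi-Riemannian submanifold $(M,\widetilde g)$ of $(\overline M,\overline{\widetilde g})$. *)

theory Defs
  imports "HOL-Analysis.Analysis"
begin

section \<open>Smooth functions between Euclidean spaces\<close>

primrec higher_differentiable_on ::
  "'a::euclidean_space set \<Rightarrow> ('a \<Rightarrow> 'b::euclidean_space) \<Rightarrow> nat \<Rightarrow> bool" where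
  "higher_differentiable_on D f 0 \<longleftrightarrow> continuous_on D f"
| "higher_differentiable_on D f (Suc k) \<longleftrightarrow>
     (\<forall>x\<in>D. f differentiable (at x)) \<and>
     (\<forall>v. higher_differentiable_on D (\<lambda>x. frechet_derivative f (at x) v) k)"

text \<open>Only used on open sets \<open>D\<close>.\<close>
definition smooth_on :: "'a::euclidean_space set \<Rightarrow> ('a \<Rightarrow> 'b::euclidean_space) \<Rightarrow> bool" where
  "smooth_on D f \<longleftrightarrow> (\<forall>k. higher_differentiable_on D f k)"


section \<open>Smooth manifolds\<close>

text \<open>A chart is a pair of its domain and its coordinate map. A manifold is a type \<open>'m\<close> (Hausdorff,
  second countable) with a smooth atlas modelled on a Euclidean space \<open>'e\<close>; its dimension is
  \<open>DIM('e)\<close>.\<close>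

type_synonym ('m, 'e) chart = "'m set \<times> ('m \<Rightarrow> 'e)"

abbreviation cdom :: "('m, 'e) chart \<Rightarrow> 'm set" where "cdom \<equiv> fst"
abbreviation cmap :: "('m, 'e) chart \<Rightarrow> 'm \<Rightarrow> 'e" where "cmap \<equiv> snd"

definition cinv :: "('m, 'e) chart \<Rightarrow> 'e \<Rightarrow> 'm" where
  "cinv c = inv_into (cdom c) (cmap c)"

definition smooth_manifold ::
  "('m::{t2_space,second_countable_topology}, 'e::euclidean_space) chart set \<Rightarrow> bool" where
  "smooth_manifold A \<longleftrightarrow>
     (\<forall>c\<in>A. open (cdom c) \<and> open (cmap c ` cdom c) \<and>
            homeomorphism (cdom c) (cmap c ` cdom c) (cmap c) (cinv c)) \<and>
     (\<Union>c\<in>A. cdom c) = UNIV \<and>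
     (\<forall>c\<in>A. \<forall>c'\<in>A. smooth_on (cmap c ` (cdom c \<inter> cdom c')) (cmap c' \<circ> cinv c))"

text \<open>The tangent space at \<open>p\<close> is identified with the model space \<open>'e\<close> through one fixed chart
  \<open>chart_at A p\<close> around \<open>p\<close>. Thus a tangent vector at \<open>p\<close> is an element of \<open>'e\<close>, a vector field is a
  function \<open>'m \<Rightarrow> 'e\<close>, an endomorphism field a function \<open>'m \<Rightarrow> 'e \<Rightarrow> 'e\<close>, and so on. The preferred
  chart may jump from point to point, so smoothness and derivatives of fields are always taken after
  passing to the coordinates of a single chart \<open>c\<close>: \<open>tcoord A c p v\<close> are the coordinates in \<open>c\<close>
  of the vector \<open>v\<close> at \<open>p\<close>, and \<open>tvec A c p u\<close> is the vector at \<open>p\<close> with coordinates \<open>u\<close> in \<open>c\<close>.\<close>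

definition chart_at :: "('m, 'e) chart set \<Rightarrow> 'm \<Rightarrow> ('m, 'e) chart" where
  "chart_at A p = (SOME c. c \<in> A \<and> p \<in> cdom c)"

definition tcoord ::
  "('m, 'e::euclidean_space) chart set \<Rightarrow> ('m, 'e) chart \<Rightarrow> 'm \<Rightarrow> 'e \<Rightarrow> 'e" where
  "tcoord A c p v =
     frechet_derivative (cmap c \<circ> cinv (chart_at A p)) (at (cmap (chart_at A p) p)) v"

definition tvec ::
  "('m, 'e::euclidean_space) chart set \<Rightarrow> ('m, 'e) chart \<Rightarrow> 'm \<Rightarrow> 'e \<Rightarrow> 'e" where
  "tvec A c p u = frechet_derivative (cmap (chart_at A p) \<circ> cinv c) (at (cmap c p)) u"

definition smooth_function_on ::
  "('m, 'e::euclidean_space) chart set \<Rightarrow> 'm set \<Rightarrow> ('m \<Rightarrow> real) \<Rightarrow> bool" where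
  "smooth_function_on A U \<phi> \<longleftrightarrow> (\<forall>c\<in>A. smooth_on (cmap c ` (cdom c \<inter> U)) (\<phi> \<circ> cinv c))"

definition smooth_vector_field_on ::
  "('m, 'e::euclidean_space) chart set \<Rightarrow> 'm set \<Rightarrow> ('m \<Rightarrow> 'e) \<Rightarrow> bool" where
  "smooth_vector_field_on A U X \<longleftrightarrow>
     (\<forall>c\<in>A. smooth_on (cmap c ` (cdom c \<inter> U)) (\<lambda>z. tcoord A c (cinv c z) (X (cinv c z))))"

text \<open>The derivative \<open>v \<phi>\<close> of a function in the direction of a tangent vector at \<open>p\<close>.\<close>
definition fun_deriv ::
  "('m, 'e::euclidean_space) chart set \<Rightarrow> ('m \<Rightarrow> real) \<Rightarrow> 'm \<Rightarrow> 'e \<Rightarrow> real" where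
  "fun_deriv A \<phi> p v =
     frechet_derivative (\<phi> \<circ> cinv (chart_at A p)) (at (cmap (chart_at A p) p)) v"

definition lie_bracket ::
  "('m, 'e::euclidean_space) chart set \<Rightarrow> ('m \<Rightarrow> 'e) \<Rightarrow> ('m \<Rightarrow> 'e) \<Rightarrow> 'm \<Rightarrow> 'e" where
  "lie_bracket A X Y p =
     (let c = chart_at A p;
          rep = (\<lambda>Z z. tcoord A c (cinv c z) (Z (cinv c z)))
      in frechet_derivative (rep Y) (at (cmap c p)) (X p)
         - frechet_derivative (rep X) (at (cmap c p)) (Y p))"


section \<open>Semi-Riemannian metrics and the Levi-Civita connection\<close>

definition nondegenerate_on :: "('v::real_vector \<Rightarrow> 'v \<Rightarrow> real) \<Rightarrow> 'v set \<Rightarrow> bool" where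
  "nondegenerate_on b W \<longleftrightarrow> (\<forall>u\<in>W. (\<forall>v\<in>W. b u v = 0) \<longrightarrow> u = 0)"

definition form_index :: "('e::euclidean_space \<Rightarrow> 'e \<Rightarrow> real) \<Rightarrow> nat" where
  "form_index b = Max {dim W | W. subspace W \<and> (\<forall>w\<in>W. w \<noteq> 0 \<longrightarrow> b w w < 0)}"

definition semi_riemannian_metric ::
  "('m::topological_space, 'e::euclidean_space) chart set \<Rightarrow> ('m \<Rightarrow> 'e \<Rightarrow> 'e \<Rightarrow> real) \<Rightarrow> bool" where
  "semi_riemannian_metric A g \<longleftrightarrow>
     (\<forall>p. bilinear (g p) \<and> (\<forall>u v. g p u v = g p v u) \<and> nondegenerate_on (g p) UNIV) \<and>
     (\<exists>k. \<forall>p. form_index (g p) = k) \<and>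
     (\<forall>U X Y. open U \<and> smooth_vector_field_on A U X \<and> smooth_vector_field_on A U Y \<longrightarrow>
        smooth_function_on A U (\<lambda>p. g p (X p) (Y p)))"

text \<open>A connection \<open>D\<close> takes a point \<open>p\<close>, a tangent vector \<open>v\<close> at \<open>p\<close> and a vector field \<open>Y\<close> that is
  smooth near \<open>p\<close>, and returns the covariant derivative of \<open>Y\<close> in direction \<open>v\<close>. Since \<open>U\<close> ranges
  over all open sets, the Leibniz rule (applied to a function vanishing outside of \<open>U\<close>) forces
  \<open>D p v Y\<close> to depend only on \<open>Y\<close> near \<open>p\<close>.\<close>

type_synonym ('m, 'e) connection = "'m \<Rightarrow> 'e \<Rightarrow> ('m \<Rightarrow> 'e) \<Rightarrow> 'e"

definition affine_connection ::
  "('m::topological_space, 'e::euclidean_space) chart set \<Rightarrow> ('m, 'e) connection \<Rightarrow> bool" where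
  "affine_connection A D \<longleftrightarrow>
     (\<forall>U X Y. open U \<and> smooth_vector_field_on A U X \<and> smooth_vector_field_on A U Y \<longrightarrow>
        smooth_vector_field_on A U (\<lambda>p. D p (X p) Y)) \<and>
     (\<forall>U Y. open U \<and> smooth_vector_field_on A U Y \<longrightarrow> (\<forall>p\<in>U. linear (\<lambda>v. D p v Y))) \<and>
     (\<forall>U Y Z. open U \<and> smooth_vector_field_on A U Y \<and> smooth_vector_field_on A U Z \<longrightarrow>
        (\<forall>p\<in>U. \<forall>v. D p v (\<lambda>q. Y q + Z q) = D p v Y + D p v Z)) \<and>
     (\<forall>U \<phi> Y. open U \<and> smooth_function_on A U \<phi> \<and> smooth_vector_field_on A U Y \<longrightarrow>
        (\<forall>p\<in>U. \<forall>v. D p v (\<lambda>q. \<phi> q *\<^sub>R Y q) = fun_deriv A \<phi> p v *\<^sub>R Y p + \<phi> p *\<^sub>R D p v Y))"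

definition levi_civita ::
  "('m::topological_space, 'e::euclidean_space) chart set \<Rightarrow> ('m \<Rightarrow> 'e \<Rightarrow> 'e \<Rightarrow> real) \<Rightarrow>
     ('m, 'e) connection \<Rightarrow> bool" where
  "levi_civita A g D \<longleftrightarrow>
     affine_connection A D \<and>
     (\<forall>U X Y. open U \<and> smooth_vector_field_on A U X \<and> smooth_vector_field_on A U Y \<longrightarrow>
        (\<forall>p\<in>U. D p (X p) Y - D p (Y p) X = lie_bracket A X Y p)) \<and>
     (\<forall>U Y Z. open U \<and> smooth_vector_field_on A U Y \<and> smooth_vector_field_on A U Z \<longrightarrow>
        (\<forall>p\<in>U. \<forall>v. fun_deriv A (\<lambda>q. g q (Y q) (Z q)) p v = g p (D p v Y) (Z p) + g p (Y p) (D p v Z)))"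


section \<open>Almost contact B-metric manifolds\<close>

definition almost_contact_B_metric_manifold ::
  "('m::{t2_space,second_countable_topology}, 'e::euclidean_space) chart set \<Rightarrow>
     ('m \<Rightarrow> 'e \<Rightarrow> 'e) \<Rightarrow> ('m \<Rightarrow> 'e) \<Rightarrow> ('m \<Rightarrow> 'e \<Rightarrow> real) \<Rightarrow> ('m \<Rightarrow> 'e \<Rightarrow> 'e \<Rightarrow> real) \<Rightarrow> bool" where
  "almost_contact_B_metric_manifold A \<phi> \<xi> \<eta> g \<longleftrightarrow>
     smooth_manifold A \<and>
     (\<forall>p. linear (\<phi> p)) \<and>
     (\<forall>U X. open U \<and> smooth_vector_field_on A U X \<longrightarrow>
        smooth_vector_field_on A U (\<lambda>p. \<phi> p (X p))) \<and>
     smooth_vector_field_on A UNIV \<xi> \<and>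
     (\<forall>p. linear (\<eta> p)) \<and>
     (\<forall>U X. open U \<and> smooth_vector_field_on A U X \<longrightarrow> smooth_function_on A U (\<lambda>p. \<eta> p (X p))) \<and>
     semi_riemannian_metric A g \<and>
     (\<forall>p u. \<phi> p (\<phi> p u) = - u + \<eta> p u *\<^sub>R \<xi> p) \<and>
     (\<forall>p. \<eta> p (\<xi> p) = 1) \<and>
     (\<forall>p u v. g p (\<phi> p u) (\<phi> p v) = - g p u v + \<eta> p u * \<eta> p v)"

definition associated_metric ::
  "('m \<Rightarrow> 'e \<Rightarrow> 'e) \<Rightarrow> ('m \<Rightarrow> 'e \<Rightarrow> real) \<Rightarrow> ('m \<Rightarrow> 'e \<Rightarrow> 'e \<Rightarrow> real) \<Rightarrow> 'm \<Rightarrow> 'e \<Rightarrow> 'e \<Rightarrow> real" where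
  "associated_metric \<phi> \<eta> g p u v = g p u (\<phi> p v) + \<eta> p u * \<eta> p v"

definition F0_manifold ::
  "('m::{t2_space,second_countable_topology}, 'e::euclidean_space) chart set \<Rightarrow>
     ('m \<Rightarrow> 'e \<Rightarrow> 'e) \<Rightarrow> ('m \<Rightarrow> 'e) \<Rightarrow> ('m \<Rightarrow> 'e \<Rightarrow> real) \<Rightarrow> ('m \<Rightarrow> 'e \<Rightarrow> 'e \<Rightarrow> real) \<Rightarrow>
     ('m, 'e) connection \<Rightarrow> bool" where
  "F0_manifold A \<phi> \<xi> \<eta> g D \<longleftrightarrow>
     almost_contact_B_metric_manifold A \<phi> \<xi> \<eta> g \<and>
     levi_civita A g D \<and>
     (\<forall>U Y. open U \<and> smooth_vector_field_on A U Y \<longrightarrow>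
        (\<forall>p\<in>U. \<forall>v w. g p (D p v (\<lambda>q. \<phi> q (Y q)) - \<phi> p (D p v Y)) w = 0))"


section \<open>Submanifolds\<close>

text \<open>\<open>M\<close> (type \<open>'n\<close>, atlas \<open>A\<close>) is a submanifold of the ambient manifold (type \<open>'m\<close>, atlas \<open>B\<close>) by
  means of an immersion \<open>f\<close>. Injectivity of \<open>f\<close> is not required, so embedded and injectively immersed
  submanifolds are included. The tangent space of \<open>M\<close> at \<open>p\<close> is the model space \<open>'f\<close>, regarded as a
  subspace of \<open>'e\<close> (the ambient tangent space at \<open>f p\<close>) by the differential of \<open>f\<close>.\<close>

definition tmap ::
  "('n, 'f::euclidean_space) chart set \<Rightarrow> ('m, 'e::euclidean_space) chart set \<Rightarrow> ('n \<Rightarrow> 'm) \<Rightarrow>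
     'n \<Rightarrow> 'f \<Rightarrow> 'e" where
  "tmap A B f p x =
     frechet_derivative (cmap (chart_at B (f p)) \<circ> f \<circ> cinv (chart_at A p))
       (at (cmap (chart_at A p) p)) x"

definition immersed_submanifold ::
  "('n::{t2_space,second_countable_topology}, 'f::euclidean_space) chart set \<Rightarrow>
     ('m::{t2_space,second_countable_topology}, 'e::euclidean_space) chart set \<Rightarrow> ('n \<Rightarrow> 'm) \<Rightarrow> bool" where
  "immersed_submanifold A B f \<longleftrightarrow>
     smooth_manifold A \<and> smooth_manifold B \<and>
     continuous_on UNIV f \<and>
     (\<forall>a\<in>A. \<forall>b\<in>B. smooth_on (cmap a ` (cdom a \<inter> f -` cdom b)) (cmap b \<circ> f \<circ> cinv a)) \<and>
     (\<forall>p. inj (tmap A B f p))"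

definition smooth_field_along_on ::
  "('n, 'f::euclidean_space) chart set \<Rightarrow> ('m, 'e::euclidean_space) chart set \<Rightarrow> ('n \<Rightarrow> 'm) \<Rightarrow>
     'n set \<Rightarrow> ('n \<Rightarrow> 'e) \<Rightarrow> bool" where
  "smooth_field_along_on A B f U V \<longleftrightarrow>
     (\<forall>a\<in>A. \<forall>b\<in>B. smooth_on (cmap a ` (cdom a \<inter> f -` cdom b \<inter> U))
        (\<lambda>z. tcoord B b (f (cinv a z)) (V (cinv a z))))"

text \<open>The ambient covariant derivative, in direction \<open>x\<close> tangent to \<open>M\<close> at \<open>p\<close>, of a vector field \<open>V\<close>
  along \<open>f\<close>. With \<open>V = (\<Sum>i. V\<^sup>i \<partial>\<^sub>i)\<close> in the coordinates of \<open>chart_at B (f p)\<close>, it is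
  \<open>(\<Sum>i. x(V\<^sup>i) \<partial>\<^sub>i + V\<^sup>i D\<^bsub>df x\<^esub> \<partial>\<^sub>i)\<close>; note that at \<open>f p\<close> itself this chart is the one
  identifying the tangent space with \<open>'e\<close>.\<close>
definition cov_along ::
  "('n, 'f::euclidean_space) chart set \<Rightarrow> ('m, 'e::euclidean_space) chart set \<Rightarrow> ('n \<Rightarrow> 'm) \<Rightarrow>
     ('m, 'e) connection \<Rightarrow> 'n \<Rightarrow> 'f \<Rightarrow> ('n \<Rightarrow> 'e) \<Rightarrow> 'e" where
  "cov_along A B f D p x V =
     (let a = chart_at A p; b = chart_at B (f p)
      in frechet_derivative (\<lambda>z. tcoord B b (f (cinv a z)) (V (cinv a z))) (at (cmap a p)) x
         + (\<Sum>i\<in>Basis. (V p \<bullet> i) *\<^sub>R D (f p) (tmap A B f p x) (\<lambda>q. tvec B b q i)))"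

text \<open>\<open>\<nabla>\<^sub>x Y\<close> for a vector \<open>x\<close> tangent to \<open>M\<close> at \<open>p\<close>, where \<open>Y\<close> is the vector field tangent to \<open>M\<close>
  extending the vector \<open>y\<close> at \<open>p\<close> with constant coordinates. Second fundamental forms are components of
  \<open>\<nabla>\<^sub>x Y\<close> transversal to \<open>M\<close>; these do not depend on the extension \<open>Y\<close>.\<close>
definition tangential_cov ::
  "('n, 'f::euclidean_space) chart set \<Rightarrow> ('m, 'e::euclidean_space) chart set \<Rightarrow> ('n \<Rightarrow> 'm) \<Rightarrow>
     ('m, 'e) connection \<Rightarrow> 'n \<Rightarrow> 'f \<Rightarrow> 'f \<Rightarrow> 'e" where
  "tangential_cov A B f D p x y =
     cov_along A B f D p x (\<lambda>q. tmap A B f q (tvec A (chart_at A p) q y))"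

definition induced_metric ::
  "('n, 'f::euclidean_space) chart set \<Rightarrow> ('m, 'e::euclidean_space) chart set \<Rightarrow> ('n \<Rightarrow> 'm) \<Rightarrow>
     ('m \<Rightarrow> 'e \<Rightarrow> 'e \<Rightarrow> real) \<Rightarrow> 'n \<Rightarrow> 'f \<Rightarrow> 'f \<Rightarrow> real" where
  "induced_metric A B f g p x y = g (f p) (tmap A B f p x) (tmap A B f p y)"

definition normal_space ::
  "('n, 'f::euclidean_space) chart set \<Rightarrow> ('m, 'e::euclidean_space) chart set \<Rightarrow> ('n \<Rightarrow> 'm) \<Rightarrow>
     ('m \<Rightarrow> 'e \<Rightarrow> 'e \<Rightarrow> real) \<Rightarrow> 'n \<Rightarrow> 'e set" where
  "normal_space A B f g p = {w. \<forall>y. g (f p) w (tmap A B f p y) = 0}"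

definition sum_space :: "'v::real_vector set \<Rightarrow> 'v set \<Rightarrow> 'v set" where
  "sum_space P Q = {u + v | u v. u \<in> P \<and> v \<in> Q}"

definition orthogonal_sum :: "('v::real_vector \<Rightarrow> 'v \<Rightarrow> real) \<Rightarrow> 'v set \<Rightarrow> 'v set \<Rightarrow> 'v set \<Rightarrow> bool" where
  "orthogonal_sum b W P Q \<longleftrightarrow>
     subspace P \<and> subspace Q \<and> W = sum_space P Q \<and> P \<inter> Q = {0} \<and> (\<forall>u\<in>P. \<forall>v\<in>Q. b u v = 0)"

text \<open>The component in \<open>Q\<close> of a vector with respect to a direct sum of \<open>P\<close> and \<open>Q\<close>.\<close>
definition component :: "'v::real_vector set \<Rightarrow> 'v set \<Rightarrow> 'v \<Rightarrow> 'v" where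
  "component P Q u = (THE w. w \<in> Q \<and> u - w \<in> P)"

definition orthonormal_basis :: "('v::real_vector \<Rightarrow> 'v \<Rightarrow> real) \<Rightarrow> 'v set \<Rightarrow> 'v set \<Rightarrow> bool" where
  "orthonormal_basis b W E \<longleftrightarrow>
     finite E \<and> independent E \<and> span E = W \<and>
     (\<forall>e\<in>E. \<bar>b e e\<bar> = 1) \<and> (\<forall>e\<in>E. \<forall>e'\<in>E. e \<noteq> e' \<longrightarrow> b e e' = 0)"

text \<open>The trace on \<open>W\<close> of a vector-valued bilinear form \<open>h\<close> with respect to a form \<open>b\<close> that is symmetric
  and non-degenerate on \<open>W\<close>; the choice of the orthonormal basis does not matter.\<close>
definition metric_trace ::
  "('v::real_vector \<Rightarrow> 'v \<Rightarrow> real) \<Rightarrow> 'v set \<Rightarrow> ('v \<Rightarrow> 'v \<Rightarrow> 'w::real_vector) \<Rightarrow> 'w" where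
  "metric_trace b W h =
     (let E = (SOME E. orthonormal_basis b W E) in \<Sum>e\<in>E. b e e *\<^sub>R h e e)"


subsection \<open>Semi-Riemannian submanifolds\<close>

definition normal_second_form ::
  "('n, 'f::euclidean_space) chart set \<Rightarrow> ('m, 'e::euclidean_space) chart set \<Rightarrow> ('n \<Rightarrow> 'm) \<Rightarrow>
     ('m \<Rightarrow> 'e \<Rightarrow> 'e \<Rightarrow> real) \<Rightarrow> ('m, 'e) connection \<Rightarrow> 'n \<Rightarrow> 'f \<Rightarrow> 'f \<Rightarrow> 'e" where
  "normal_second_form A B f g D p x y =
     component (range (tmap A B f p)) (normal_space A B f g p) (tangential_cov A B f D p x y)"

definition minimal_semi_riemannian ::
  "('n, 'f::euclidean_space) chart set \<Rightarrow> ('m, 'e::euclidean_space) chart set \<Rightarrow> ('n \<Rightarrow> 'm) \<Rightarrow>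
     ('m \<Rightarrow> 'e \<Rightarrow> 'e \<Rightarrow> real) \<Rightarrow> ('m, 'e) connection \<Rightarrow> bool" where
  "minimal_semi_riemannian A B f g D \<longleftrightarrow>
     (\<forall>p. metric_trace (induced_metric A B f g p) UNIV (normal_second_form A B f g D p) = 0)"


subsection \<open>Half lightlike submanifolds\<close>

text \<open>\<open>Rad(TM) = TM \<inter> TM\<^sup>\<bottom>\<close>, as a subspace of the tangent space of \<open>M\<close>.\<close>
definition radical ::
  "('n, 'f::euclidean_space) chart set \<Rightarrow> ('m, 'e::euclidean_space) chart set \<Rightarrow> ('n \<Rightarrow> 'm) \<Rightarrow>
     ('m \<Rightarrow> 'e \<Rightarrow> 'e \<Rightarrow> real) \<Rightarrow> 'n \<Rightarrow> 'f set" where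
  "radical A B f g p = {x. tmap A B f p x \<in> normal_space A B f g p}"

text \<open>A smooth subbundle of rank \<open>k\<close>, where \<open>smooth_sec U\<close> are the smooth sections over \<open>U\<close> of the
  surrounding bundle.\<close>
definition smooth_subbundle ::
  "('n::topological_space set \<Rightarrow> ('n \<Rightarrow> 'v::euclidean_space) \<Rightarrow> bool) \<Rightarrow> nat \<Rightarrow> ('n \<Rightarrow> 'v set) \<Rightarrow> bool" where
  "smooth_subbundle smooth_sec k W \<longleftrightarrow>
     (\<forall>p. subspace (W p) \<and> dim (W p) = k) \<and>
     (\<forall>p. \<exists>U X. open U \<and> p \<in> U \<and> (\<forall>i<k. smooth_sec U (X i)) \<and>
        (\<forall>q\<in>U. W q = span ((\<lambda>i. X i q) ` {..<k})))"

text \<open>\<open>S\<close> is the screen distribution \<open>S(TM)\<close>, as a distribution on \<open>M\<close>, and \<open>T\<close> is the screen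
  transversal bundle \<open>S(TM\<^sup>\<bottom>)\<close>.\<close>
definition half_lightlike_submanifold ::
  "('n::{t2_space,second_countable_topology}, 'f::euclidean_space) chart set \<Rightarrow>
     ('m::{t2_space,second_countable_topology}, 'e::euclidean_space) chart set \<Rightarrow> ('n \<Rightarrow> 'm) \<Rightarrow>
     ('m \<Rightarrow> 'e \<Rightarrow> 'e \<Rightarrow> real) \<Rightarrow> ('n \<Rightarrow> 'f set) \<Rightarrow> ('n \<Rightarrow> 'e set) \<Rightarrow> bool" where
  "half_lightlike_submanifold A B f g S T \<longleftrightarrow>
     immersed_submanifold A B f \<and> DIM('e) = DIM('f) + 2 \<and>
     (\<forall>p. dim (radical A B f g p) = 1) \<and>
     smooth_subbundle (smooth_vector_field_on A) (DIM('f) - 1) S \<and>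
     smooth_subbundle (smooth_field_along_on A B f) 1 T \<and>
     (\<forall>p. nondegenerate_on (induced_metric A B f g p) (S p) \<and>
          nondegenerate_on (g (f p)) (T p) \<and>
          orthogonal_sum (induced_metric A B f g p) UNIV (radical A B f g p) (S p) \<and>
          orthogonal_sum (g (f p)) (normal_space A B f g p)
            (tmap A B f p ` radical A B f g p) (T p))"

text \<open>The line spanned by the vector \<open>N\<close>; a different choice of \<open>\<xi>\<close> in the radical only rescales \<open>N\<close>.\<close>
definition ltr ::
  "('n, 'f::euclidean_space) chart set \<Rightarrow> ('m, 'e::euclidean_space) chart set \<Rightarrow> ('n \<Rightarrow> 'm) \<Rightarrow>
     ('m \<Rightarrow> 'e \<Rightarrow> 'e \<Rightarrow> real) \<Rightarrow> ('n \<Rightarrow> 'f set) \<Rightarrow> ('n \<Rightarrow> 'e set) \<Rightarrow> 'n \<Rightarrow> 'e set" where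
  "ltr A B f g S T p =
     span {N. (\<exists>\<xi>\<in>radical A B f g p. g (f p) N (tmap A B f p \<xi>) = 1) \<and>
              g (f p) N N = 0 \<and> (\<forall>l\<in>T p. g (f p) N l = 0) \<and>
              (\<forall>x\<in>S p. g (f p) N (tmap A B f p x) = 0)}"

text \<open>The second fundamental form \<open>h\<close> and its \<open>S(TM\<^sup>\<bottom>)\<close>-component \<open>h\<^sup>S\<close>.\<close>
definition transversal_second_form ::
  "('n, 'f::euclidean_space) chart set \<Rightarrow> ('m, 'e::euclidean_space) chart set \<Rightarrow> ('n \<Rightarrow> 'm) \<Rightarrow>
     ('m \<Rightarrow> 'e \<Rightarrow> 'e \<Rightarrow> real) \<Rightarrow> ('m, 'e) connection \<Rightarrow> ('n \<Rightarrow> 'f set) \<Rightarrow> ('n \<Rightarrow> 'e set) \<Rightarrow>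
     'n \<Rightarrow> 'f \<Rightarrow> 'f \<Rightarrow> 'e" where
  "transversal_second_form A B f g D S T p x y =
     component (range (tmap A B f p)) (sum_space (ltr A B f g S T p) (T p))
       (tangential_cov A B f D p x y)"

definition screen_second_form ::
  "('n, 'f::euclidean_space) chart set \<Rightarrow> ('m, 'e::euclidean_space) chart set \<Rightarrow> ('n \<Rightarrow> 'm) \<Rightarrow>
     ('m \<Rightarrow> 'e \<Rightarrow> 'e \<Rightarrow> real) \<Rightarrow> ('m, 'e) connection \<Rightarrow> ('n \<Rightarrow> 'f set) \<Rightarrow> ('n \<Rightarrow> 'e set) \<Rightarrow>
     'n \<Rightarrow> 'f \<Rightarrow> 'f \<Rightarrow> 'e" where
  "screen_second_form A B f g D S T p x y =
     component (ltr A B f g S T p) (T p) (transversal_second_form A B f g D S T p x y)"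

definition minimal_half_lightlike ::
  "('n, 'f::euclidean_space) chart set \<Rightarrow> ('m, 'e::euclidean_space) chart set \<Rightarrow> ('n \<Rightarrow> 'm) \<Rightarrow>
     ('m \<Rightarrow> 'e \<Rightarrow> 'e \<Rightarrow> real) \<Rightarrow> ('m, 'e) connection \<Rightarrow> ('n \<Rightarrow> 'f set) \<Rightarrow> ('n \<Rightarrow> 'e set) \<Rightarrow> bool" where
  "minimal_half_lightlike A B f g D S T \<longleftrightarrow>
     (\<forall>p. (\<forall>x\<in>radical A B f g p. screen_second_form A B f g D S T p x x = 0) \<and>
          metric_trace (induced_metric A B f g p) (S p) (transversal_second_form A B f g D S T p) = 0)"

definition radical_screen_transversal ::
  "('n::{t2_space,second_countable_topology}, 'f::euclidean_space) chart set \<Rightarrow>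
     ('m::{t2_space,second_countable_topology}, 'e::euclidean_space) chart set \<Rightarrow> ('n \<Rightarrow> 'm) \<Rightarrow>
     ('m \<Rightarrow> 'e \<Rightarrow> 'e) \<Rightarrow> ('m \<Rightarrow> 'e \<Rightarrow> 'e \<Rightarrow> real) \<Rightarrow> ('n \<Rightarrow> 'f set) \<Rightarrow> ('n \<Rightarrow> 'e set) \<Rightarrow> bool" where
  "radical_screen_transversal A B f \<phi> g S T \<longleftrightarrow>
     half_lightlike_submanifold A B f g S T \<and>
     (\<forall>p. \<phi> (f p) ` tmap A B f p ` radical A B f g p = T p)"

definition ascreen ::
  "('n, 'f::euclidean_space) chart set \<Rightarrow> ('m, 'e::euclidean_space) chart set \<Rightarrow> ('n \<Rightarrow> 'm) \<Rightarrow>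
     ('m \<Rightarrow> 'e) \<Rightarrow> ('m \<Rightarrow> 'e \<Rightarrow> 'e \<Rightarrow> real) \<Rightarrow> ('n \<Rightarrow> 'f set) \<Rightarrow> ('n \<Rightarrow> 'e set) \<Rightarrow> bool" where
  "ascreen A B f \<xi> g S T \<longleftrightarrow>
     (\<forall>p. \<xi> (f p) \<in> sum_space (tmap A B f p ` radical A B f g p) (ltr A B f g S T p))"

end

theory Submission
  imports Defs
begin

text \<open>
  Since \<open>D\<close> preserves \<open>\<phi>\<close>, it annihilates \<open>\<xi>\<close>, hence preserves the associated metric and coincides
  with \<open>D'\<close>; both minimality conditions concern the same tensor \<open>H\<close>, the covariant derivative of tangent
  fields modulo the tangent space \<open>TM\<close>, as the trace is killed by a projection along \<open>TM\<close> iff it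
  lies in \<open>TM\<close>. Let \<open>L\<close> be a local section of the screen transversal bundle, \<open>L = \<phi> r\<close> with
  \<open>r\<close> in the radical, and \<open>\<Lambda>\<close> its covariant derivative. At each point \<open>TM\<close> is the orthogonal
  complement of \<open>r\<close> and \<open>L\<close>, so \<open>H\<close> is determined by its products with these two vectors.
  To avoid smooth sections of the radical, these are found by differentiating the identities
  \<open>g Y L = 0\<close>, \<open>g (\<phi> L) L = 0\<close>, \<open>\<eta> L = 0\<close> and
  \<open>g (\<phi> L) Y * g (\<phi> L) W = g L L * (\<eta> Y * \<eta> W)\<close> for tangent fields \<open>Y\<close>, \<open>W\<close>. One gets \<open>H x r = 0\<close> and,
  on the screen distribution, \<open>g (H x s) L = - g (\<Lambda> x) s\<close> and \<open>g (H x s) r = g (\<Lambda> x) (\<phi> s)\<close>.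
  As the screen distribution is \<open>\<phi>\<close>-invariant and the associated metric on it is
  \<open>g s (\<phi> s')\<close>, passing from one trace to the other exchanges the two products up to sign.
\<close>

section \<open>Composition of smooth maps\<close>

text \<open>On an open set the derivative at a point depends only on the values inside the set, so
  agreement passes to all iterated derivatives. Fields read in charts agree with their formulas only
  on such sets.\<close>

lemma higher_differentiable_on_cong:
  assumes "open S" "\<And>x. x \<in> S \<Longrightarrow> f x = g x"
  shows "higher_differentiable_on S f k = higher_differentiable_on S g k"
  using assms(2)
proof (induction k arbitrary: f g)
  case 0
  then have "continuous_on S f \<longleftrightarrow> continuous_on S g" by (intro continuous_on_cong) simp_all
  then show ?case by simp
next
  case (Suc k)
  have d: "(f has_derivative D) (at x) \<longleftrightarrow> (g has_derivative D) (at x)" if "x \<in> S" for x D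
    using Suc.prems that
      has_derivative_transform_within_open[of f D x UNIV S g, OF _ assms(1) that]
      has_derivative_transform_within_open[of g D x UNIV S f, OF _ assms(1) that]
    by force
  then have diff: "f differentiable (at x) \<longleftrightarrow> g differentiable (at x)" if "x \<in> S" for x
    using that by (simp add: differentiable_def)
  have "higher_differentiable_on S (\<lambda>x. frechet_derivative f (at x) v) k =
    higher_differentiable_on S (\<lambda>x. frechet_derivative g (at x) v) k" for v
    by (rule Suc.IH) (simp add: frechet_derivative_def d)
  then show ?case using diff by simp
qed

text \<open>Lets the closure rules below work with an explicit formula for the derivative in place
  of \<open>frechet_derivative\<close>.\<close>

lemma higher_differentiable_on_SucI:
  assumes "open S" "\<And>x. x \<in> S \<Longrightarrow> (f has_derivative f' x) (at x)"
    and "\<And>v. higher_differentiable_on S (\<lambda>x. f' x v) k"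
  shows "higher_differentiable_on S f (Suc k)"
proof -
  have "higher_differentiable_on S (\<lambda>x. frechet_derivative f (at x) v) k" for v
    by (rule higher_differentiable_on_cong[THEN iffD2, OF assms(1) _ assms(3)[of v]])
      (simp add: frechet_derivative_at[OF assms(2), symmetric])
  then show ?thesis using assms(2) by (auto simp: differentiable_def)
qed

lemma higher_differentiable_on_has_derivative:
  assumes "higher_differentiable_on S f (Suc k)" "x \<in> S"
  shows "(f has_derivative frechet_derivative f (at x)) (at x)"
  using assms by (simp add: frechet_derivative_works[symmetric])

lemma higher_differentiable_on_mono:
  assumes "higher_differentiable_on S f k" "j \<le> k"
  shows "higher_differentiable_on S f j"
  using assms
proof (induction k arbitrary: f j)
  case 0
  then show ?case by simp
next
  case (Suc k)
  show ?case
  proof (cases j)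
    case 0
    with Suc.prems show ?thesis
      by (simp add: continuous_at_imp_continuous_on differentiable_imp_continuous_within)
  next
    case (Suc i)
    with Suc.prems show ?thesis by (simp add: Suc.IH)
  qed
qed

lemma higher_differentiable_on_subset:
  assumes "higher_differentiable_on S f k" "S' \<subseteq> S"
  shows "higher_differentiable_on S' f k"
  using assms
proof (induction k arbitrary: f)
  case 0
  then show ?case using continuous_on_subset by auto
next
  case (Suc k)
  then show ?case by (simp add: subset_iff)
qed

lemma higher_differentiable_on_const: "higher_differentiable_on S (\<lambda>x. c) k"
  by (induction k arbitrary: c) simp_all

lemma higher_differentiable_on_add:
  assumes "open S" "higher_differentiable_on S f k" "higher_differentiable_on S g k"
  shows "higher_differentiable_on S (\<lambda>x. f x + g x) k"
  using assms(2,3)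
proof (induction k arbitrary: f g)
  case 0
  then show ?case by (simp add: continuous_on_add)
next
  case (Suc k)
  show ?case
  proof (rule higher_differentiable_on_SucI[OF assms(1)])
    show "((\<lambda>x. f x + g x) has_derivative
      (\<lambda>v. frechet_derivative f (at x) v + frechet_derivative g (at x) v)) (at x)" if "x \<in> S" for x
      using Suc.prems that by (intro has_derivative_add higher_differentiable_on_has_derivative)
  qed (use Suc in simp)
qed

lemma higher_differentiable_on_sum:
  assumes "open S" "\<And>i. i \<in> I \<Longrightarrow> higher_differentiable_on S (f i) k"
  shows "higher_differentiable_on S (\<lambda>x. \<Sum>i\<in>I. f i x) k"
  using assms(2)
  by (induction I rule: infinite_finite_induct)
    (simp_all add: higher_differentiable_on_const higher_differentiable_on_add[OF assms(1)])

lemma higher_differentiable_on_scaleR: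
  fixes f :: "'a::euclidean_space \<Rightarrow> real" and g :: "'a \<Rightarrow> 'b::euclidean_space"
  assumes "open S" "higher_differentiable_on S f k" "higher_differentiable_on S g k"
  shows "higher_differentiable_on S (\<lambda>x. f x *\<^sub>R g x) k"
  using assms(2,3)
proof (induction k arbitrary: f g)
  case 0
  then show ?case by (simp add: continuous_on_scaleR)
next
  case (Suc k)
  show ?case
  proof (rule higher_differentiable_on_SucI[OF assms(1)])
    show "((\<lambda>x. f x *\<^sub>R g x) has_derivative
        (\<lambda>v. f x *\<^sub>R frechet_derivative g (at x) v + frechet_derivative f (at x) v *\<^sub>R g x)) (at x)"
      if "x \<in> S" for x
      using Suc.prems that by (intro has_derivative_scaleR higher_differentiable_on_has_derivative)
    \<comment> \<open>The product rule leaves one factor undifferentiated in each term, so the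
      induction hypothesis also needs \<open>f\<close> and \<open>g\<close> themselves at order
      \<open>k\<close>.\<close>
    have "higher_differentiable_on S f k" "higher_differentiable_on S g k"
      using Suc.prems[THEN higher_differentiable_on_mono, of k] by simp_all
    then show "higher_differentiable_on S
        (\<lambda>x. f x *\<^sub>R frechet_derivative g (at x) v + frechet_derivative f (at x) v *\<^sub>R g x) k" for v
      using Suc by (simp add: higher_differentiable_on_add[OF assms(1)])
  qed
qed

lemma higher_differentiable_on_inner_const:
  fixes f :: "'a::euclidean_space \<Rightarrow> 'b::euclidean_space"
  assumes "open S" "higher_differentiable_on S f k"
  shows "higher_differentiable_on S (\<lambda>x. f x \<bullet> c) k"
  using assms(2)
proof (induction k arbitrary: f)
  case 0
  then show ?case by (simp add: continuous_on_inner)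
next
  case (Suc k)
  show ?case
  proof (rule higher_differentiable_on_SucI[OF assms(1)])
    show "((\<lambda>x. f x \<bullet> c) has_derivative (\<lambda>v. frechet_derivative f (at x) v \<bullet> c)) (at x)"
      if "x \<in> S" for x
      using Suc.prems that by (intro has_derivative_inner_left higher_differentiable_on_has_derivative)
  qed (use Suc in simp)
qed

lemma linear_componentwise_expansion:
  fixes F :: "'a::euclidean_space \<Rightarrow> 'b::real_vector"
  assumes "linear F"
  shows "F w = (\<Sum>i\<in>Basis. (w \<bullet> i) *\<^sub>R F i)"
proof -
  have "F (\<Sum>i\<in>Basis. (w \<bullet> i) *\<^sub>R i) = (\<Sum>i\<in>Basis. (w \<bullet> i) *\<^sub>R F i)"
    by (simp only: linear_sum[OF assms] linear_scale[OF assms])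
  then show ?thesis by (simp only: euclidean_representation)
qed

text \<open>Expanding the chain rule in the standard basis turns the derivative into a sum of
  components of the derivative of \<open>g\<close> times partial derivatives of \<open>f\<close>
  composed with the same \<open>g\<close>. Hence the induction varies \<open>f\<close> only.\<close>

lemma higher_differentiable_on_compose:
  fixes f :: "'b::euclidean_space \<Rightarrow> 'c::euclidean_space" and g :: "'a::euclidean_space \<Rightarrow> 'b"
  assumes "open S" "g ` S \<subseteq> T"
    and "higher_differentiable_on T f k" "higher_differentiable_on S g k"
  shows "higher_differentiable_on S (\<lambda>x. f (g x)) k"
  using assms(3,4)
proof (induction k arbitrary: f)
  case 0
  then show ?case using assms(2) continuous_on_compose2 by auto
next
  case (Suc k)
  have hg: "higher_differentiable_on S g k"
    using Suc.prems(2) by (rule higher_differentiable_on_mono) simp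
  show ?case
  proof (rule higher_differentiable_on_SucI[OF assms(1)])
    fix x assume x: "x \<in> S"
    then have f: "(f has_derivative frechet_derivative f (at (g x))) (at (g x))"
      using assms(2) by (intro higher_differentiable_on_has_derivative[OF Suc.prems(1)]) auto
    have g: "(g has_derivative frechet_derivative g (at x)) (at x)"
      using higher_differentiable_on_has_derivative[OF Suc.prems(2) x] .
    have lin: "linear (frechet_derivative f (at (g x)))"
      using f by (rule has_derivative_linear)
    have "frechet_derivative f (at (g x)) w =
        (\<Sum>i\<in>Basis. (w \<bullet> i) *\<^sub>R frechet_derivative f (at (g x)) i)" for w
      using lin by (rule linear_componentwise_expansion)
    then have eq: "(\<lambda>v. frechet_derivative f (at (g x)) (frechet_derivative g (at x) v)) =
        (\<lambda>v. \<Sum>i\<in>Basis. (frechet_derivative g (at x) v \<bullet> i) *\<^sub>R frechet_derivative f (at (g x)) i)"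
      by blast
    from has_derivative_compose[OF g f] eq
    show "((\<lambda>x. f (g x)) has_derivative (\<lambda>v. \<Sum>i\<in>Basis.
        (frechet_derivative g (at x) v \<bullet> i) *\<^sub>R frechet_derivative f (at (g x)) i)) (at x)"
      by (rule has_derivative_eq_rhs)
  next
    fix v
    show "higher_differentiable_on S (\<lambda>x. \<Sum>i\<in>Basis.
        (frechet_derivative g (at x) v \<bullet> i) *\<^sub>R frechet_derivative f (at (g x)) i) k"
      using Suc.prems hg
      by (intro higher_differentiable_on_sum higher_differentiable_on_scaleR
          higher_differentiable_on_inner_const assms(1) Suc.IH) simp_all
  qed
qed

lemma smooth_on_compose:
  fixes f :: "'b::euclidean_space \<Rightarrow> 'c::euclidean_space" and g :: "'a::euclidean_space \<Rightarrow> 'b"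
  assumes "open S" "g ` S \<subseteq> T" "smooth_on T f" "smooth_on S g"
  shows "smooth_on S (\<lambda>x. f (g x))"
  using assms(3,4) unfolding smooth_on_def by (blast intro: higher_differentiable_on_compose[OF assms(1,2)])

lemma smooth_on_cong:
  assumes "open S" "\<And>x. x \<in> S \<Longrightarrow> f x = g x"
  shows "smooth_on S f = smooth_on S g"
proof -
  have "higher_differentiable_on S f k = higher_differentiable_on S g k" for k
    using assms by (rule higher_differentiable_on_cong)
  then show ?thesis unfolding smooth_on_def by blast
qed

lemma smooth_on_subset: "smooth_on S f \<Longrightarrow> S' \<subseteq> S \<Longrightarrow> smooth_on S' f"
  unfolding smooth_on_def by (blast intro: higher_differentiable_on_subset)

lemma smooth_on_differentiable:
  assumes "smooth_on S f" "x \<in> S"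
  shows "f differentiable (at x)"
proof -
  have "higher_differentiable_on S f (Suc 0)" using assms(1) unfolding smooth_on_def by blast
  then show ?thesis using assms(2) by simp
qed

lemma smooth_on_frechet_derivative:
  assumes "smooth_on S f"
  shows "smooth_on S (\<lambda>x. frechet_derivative f (at x) v)"
  unfolding smooth_on_def
proof
  fix k
  have "higher_differentiable_on S f (Suc k)" using assms unfolding smooth_on_def by blast
  then show "higher_differentiable_on S (\<lambda>x. frechet_derivative f (at x) v) k" by simp
qed


section \<open>Charts and coordinate fields\<close>

lemma chart_at_mem:
  assumes "smooth_manifold A"
  shows "chart_at A p \<in> A" "p \<in> cdom (chart_at A p)"
proof -
  have "\<exists>c. c \<in> A \<and> p \<in> cdom c"
    using assms unfolding smooth_manifold_def by blast
  from someI_ex[OF this] show "chart_at A p \<in> A" "p \<in> cdom (chart_at A p)"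
    unfolding chart_at_def by blast+
qed

lemma cinv_cmap:
  assumes "smooth_manifold A" "c \<in> A" "p \<in> cdom c"
  shows "cinv c (cmap c p) = p"
  using assms unfolding smooth_manifold_def homeomorphism_def by blast

lemma open_cdom: "smooth_manifold A \<Longrightarrow> c \<in> A \<Longrightarrow> open (cdom c)"
  unfolding smooth_manifold_def by blast

lemma open_chart_image:
  assumes "smooth_manifold A" "c \<in> A" "open U"
  shows "open (cmap c ` (cdom c \<inter> U))"
proof -
  have o: "open (cmap c ` cdom c)"
    and h: "homeomorphism (cdom c) (cmap c ` cdom c) (cmap c) (cinv c)"
    using assms unfolding smooth_manifold_def by blast+
  have "openin (top_of_set (cdom c)) (cdom c \<inter> U)"
    using assms(3) by (rule openin_open_Int)
  then have "openin (top_of_set (cmap c ` cdom c)) (cmap c ` (cdom c \<inter> U))"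
    by (rule homeomorphism_imp_open_map[OF h])
  then show ?thesis using o openin_open_eq by blast
qed

text \<open>The factorization through the chart \<open>b\<close> is valid only where
  \<open>f\<close> lands in \<open>cdom b\<close>. Continuity of \<open>f\<close> makes this an open
  condition, which is enough for derivatives at \<open>cmap a p\<close>.\<close>

lemma has_derivative_chart_chain:
  assumes A: "smooth_manifold A" and B: "smooth_manifold B" and "a \<in> A" "b \<in> B"
    and p: "p \<in> cdom a" "f p \<in> cdom b" and "continuous_on UNIV f"
    and h: "(\<lambda>w. h (cinv b w)) differentiable (at (cmap b (f p)))"
    and f: "(cmap b \<circ> f \<circ> cinv a) differentiable (at (cmap a p))"
  shows "((\<lambda>z. h (f (cinv a z))) has_derivative
    (\<lambda>v. frechet_derivative (\<lambda>w. h (cinv b w)) (at (cmap b (f p)))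
      (frechet_derivative (cmap b \<circ> f \<circ> cinv a) (at (cmap a p)) v))) (at (cmap a p))"
proof -
  have "open (f -` cdom b)"
    using open_vimage[OF open_cdom[OF B \<open>b \<in> B\<close>] \<open>continuous_on UNIV f\<close>] .
  then have o: "open (cmap a ` (cdom a \<inter> f -` cdom b))"
    using open_chart_image A \<open>a \<in> A\<close> by blast
  have "(cmap b \<circ> f \<circ> cinv a) (cmap a p) = cmap b (f p)"
    using cinv_cmap[OF A \<open>a \<in> A\<close> p(1)] by simp
  with h have h': "((\<lambda>w. h (cinv b w)) has_derivative
      frechet_derivative (\<lambda>w. h (cinv b w)) (at (cmap b (f p))))
      (at ((cmap b \<circ> f \<circ> cinv a) (cmap a p)))"
    by (simp add: frechet_derivative_works[symmetric])
  have f': "((cmap b \<circ> f \<circ> cinv a) has_derivative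
      frechet_derivative (cmap b \<circ> f \<circ> cinv a) (at (cmap a p))) (at (cmap a p))"
    using f by (simp add: frechet_derivative_works[symmetric])
  from has_derivative_compose[OF f' h'] o show ?thesis
  proof (rule has_derivative_transform_within_open)
    show "cmap a p \<in> cmap a ` (cdom a \<inter> f -` cdom b)" using p by blast
    fix z assume "z \<in> cmap a ` (cdom a \<inter> f -` cdom b)"
    then show "h (cinv b ((cmap b \<circ> f \<circ> cinv a) z)) = h (f (cinv a z))"
      using cinv_cmap[OF A \<open>a \<in> A\<close>] cinv_cmap[OF B \<open>b \<in> B\<close>] by auto
  qed
qed

section \<open>Transition maps and coordinate vector fields\<close>

lemma smooth_transition:
  assumes "smooth_manifold A" "c \<in> A" "c' \<in> A"
  shows "smooth_on (cmap c ` (cdom c \<inter> cdom c')) (\<lambda>z. cmap c' (cinv c z))"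
  using assms unfolding smooth_manifold_def comp_def by blast

lemma differentiable_transition:
  assumes "smooth_manifold A" "c \<in> A" "c' \<in> A" "q \<in> cdom c" "q \<in> cdom c'"
  shows "(\<lambda>z. cmap c' (cinv c z)) differentiable (at (cmap c q))"
  using assms by (blast intro: smooth_on_differentiable[OF smooth_transition])

text \<open>The chain rule in charts for the identity map: it moves a derivative from one chart to
  another, and is how preferred charts are eliminated.\<close>

lemma frechet_chart_change:
  assumes A: "smooth_manifold A" and "c \<in> A" "c' \<in> A" "q \<in> cdom c" "q \<in> cdom c'"
    and "(\<lambda>w. h (cinv c' w)) differentiable (at (cmap c' q))"
  shows "frechet_derivative (\<lambda>w. h (cinv c' w)) (at (cmap c' q))
      (frechet_derivative (\<lambda>z. cmap c' (cinv c z)) (at (cmap c q)) v)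
    = frechet_derivative (\<lambda>z. h (cinv c z)) (at (cmap c q)) v"
proof -
  have "((\<lambda>z. h (id (cinv c z))) has_derivative
    (\<lambda>v. frechet_derivative (\<lambda>w. h (cinv c' w)) (at (cmap c' (id q)))
      (frechet_derivative (cmap c' \<circ> id \<circ> cinv c) (at (cmap c q)) v))) (at (cmap c q))"
    using assms differentiable_transition[OF A]
    by (intro has_derivative_chart_chain[OF A A]) (simp_all add: comp_def)
  from fun_cong[OF frechet_derivative_at[OF this], of v] show ?thesis
    by (simp add: comp_def)
qed

lemma tcoord_tvec_transition:
  assumes A: "smooth_manifold A" and "c \<in> A" "c' \<in> A" "q \<in> cdom c" "q \<in> cdom c'"
  shows "tcoord A c' q (tvec A c q v) = frechet_derivative (\<lambda>z. cmap c' (cinv c z)) (at (cmap c q)) v"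
  unfolding tcoord_def tvec_def comp_def
  using assms chart_at_mem[OF A, of q]
  by (intro frechet_chart_change differentiable_transition)

lemma frechet_transition_self:
  assumes A: "smooth_manifold A" and "c \<in> A" "q \<in> cdom c"
  shows "frechet_derivative (\<lambda>z. cmap c (cinv c z)) (at (cmap c q)) v = v"
proof -
  have "((\<lambda>z. cmap c (cinv c z)) has_derivative (\<lambda>v. v)) (at (cmap c q))"
  proof (rule has_derivative_transform_within_open[OF has_derivative_ident])
    show "open (cmap c ` (cdom c \<inter> UNIV))" using A assms(2) by (intro open_chart_image) simp_all
  qed (use assms cinv_cmap in fastforce)+
  from frechet_derivative_at[OF this] show ?thesis by metis
qed

lemma tvec_tcoord:
  assumes A: "smooth_manifold A" and "c \<in> A" "q \<in> cdom c"
  shows "tvec A c q (tcoord A c q v) = v"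
proof -
  let ?a = "chart_at A q"
  have "tvec A c q (tcoord A c q v) = frechet_derivative (\<lambda>z. cmap ?a (cinv ?a z)) (at (cmap ?a q)) v"
    unfolding tcoord_def tvec_def comp_def
    using assms chart_at_mem[OF A, of q]
    by (intro frechet_chart_change differentiable_transition)
  then show ?thesis using frechet_transition_self[OF A chart_at_mem[OF A]] by simp
qed

lemma tvec_chart_at: "smooth_manifold A \<Longrightarrow> tvec A (chart_at A q) q v = v"
  unfolding tvec_def comp_def by (simp add: frechet_transition_self chart_at_mem)

lemma tcoord_chart_at: "smooth_manifold A \<Longrightarrow> tcoord A (chart_at A q) q v = v"
  unfolding tcoord_def comp_def by (simp add: frechet_transition_self chart_at_mem)

lemma linear_tvec:
  assumes A: "smooth_manifold A" and "c \<in> A" "q \<in> cdom c"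
  shows "linear (tvec A c q)"
  unfolding tvec_def comp_def
  using assms chart_at_mem[OF A, of q] by (intro linear_frechet_derivative differentiable_transition)

text \<open>In another chart \<open>c\<close> the components are a partial derivative of the
  transition map, composed with the inverse transition. The preferred charts, which may jump from
  point to point, cancel.\<close>

lemma smooth_coordinate_field:
  assumes A: "smooth_manifold A" and b: "b \<in> A"
  shows "smooth_vector_field_on A (cdom b) (\<lambda>q. tvec A b q v)"
  unfolding smooth_vector_field_on_def
proof
  fix c assume c: "c \<in> A"
  let ?S = "cmap c ` (cdom c \<inter> cdom b)" and ?T = "cmap b ` (cdom b \<inter> cdom c)"
  have o: "open ?S" using open_chart_image[OF A c open_cdom[OF A b]] .
  have "smooth_on ?S (\<lambda>z. frechet_derivative (\<lambda>w. cmap c (cinv b w)) (at (cmap b (cinv c z))) v)"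
  proof (rule smooth_on_compose[OF o, where T = ?T and g = "\<lambda>z. cmap b (cinv c z)"
        and f = "\<lambda>y. frechet_derivative (\<lambda>w. cmap c (cinv b w)) (at y) v"])
    show "smooth_on ?T (\<lambda>y. frechet_derivative (\<lambda>w. cmap c (cinv b w)) (at y) v)"
      using smooth_transition[OF A b c] by (rule smooth_on_frechet_derivative)
    show "(\<lambda>z. cmap b (cinv c z)) ` ?S \<subseteq> ?T" using cinv_cmap[OF A c] by auto
    show "smooth_on ?S (\<lambda>z. cmap b (cinv c z))" by (rule smooth_transition[OF A c b])
  qed
  then show "smooth_on ?S (\<lambda>z. tcoord A c (cinv c z) (tvec A b (cinv c z) v))"
  proof (rule smooth_on_cong[THEN iffD1, OF o, rotated])
    fix z assume "z \<in> ?S"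
    then have "cinv c z \<in> cdom c" "cinv c z \<in> cdom b" using cinv_cmap[OF A c] by auto
    then show "frechet_derivative (\<lambda>w. cmap c (cinv b w)) (at (cmap b (cinv c z))) v
        = tcoord A c (cinv c z) (tvec A b (cinv c z) v)"
      by (simp add: tcoord_tvec_transition[OF A b c])
  qed
qed

section \<open>Parallel forms along an immersion\<close>

text \<open>Written with derivatives in the preferred chart at \<open>r\<close>, so that differentiability of the
  values on smooth fields is part of the notion.\<close>
definition parallel_2form ::
  "('m, 'e::euclidean_space) chart set \<Rightarrow> ('m::topological_space, 'e) connection \<Rightarrow>
     ('m \<Rightarrow> 'e \<Rightarrow> 'e \<Rightarrow> real) \<Rightarrow> bool" where
  "parallel_2form B D \<beta> \<longleftrightarrow> (\<forall>r. bilinear (\<beta> r)) \<and>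
     (\<forall>U Y Z r. open U \<and> smooth_vector_field_on B U Y \<and> smooth_vector_field_on B U Z \<and> r \<in> U \<longrightarrow>
        ((\<lambda>z. \<beta> (cinv (chart_at B r) z) (Y (cinv (chart_at B r) z)) (Z (cinv (chart_at B r) z)))
          has_derivative (\<lambda>v. \<beta> r (D r v Y) (Z r) + \<beta> r (Y r) (D r v Z)))
          (at (cmap (chart_at B r) r)))"

text \<open>This is the regularity under which the derivative in \<open>cov_along\<close> at
  \<open>p\<close> is meaningful. It is shared by local sections of the screen transversal bundle
  and by the tangent fields in \<open>tangential_cov\<close>.\<close>

definition differentiable_along_at ::
  "('n, 'f::euclidean_space) chart set \<Rightarrow> ('m, 'e::euclidean_space) chart set \<Rightarrow> ('n \<Rightarrow> 'm) \<Rightarrow>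
     'n \<Rightarrow> ('n \<Rightarrow> 'e) \<Rightarrow> bool" where
  "differentiable_along_at A B f p V \<longleftrightarrow>
     (\<lambda>z. tcoord B (chart_at B (f p)) (f (cinv (chart_at A p) z)) (V (cinv (chart_at A p) z)))
       differentiable (at (cmap (chart_at A p) p))"

lemma linear_double_expansion:
  fixes b :: "'e::euclidean_space \<Rightarrow> 'e \<Rightarrow> real"
  assumes "bilinear b"
  shows "b u w = (\<Sum>i\<in>Basis. \<Sum>j\<in>Basis. (u \<bullet> i) * (w \<bullet> j) * b i j)"
proof -
  have "linear (\<lambda>x. b x w)" "\<And>x. linear (b x)" using assms unfolding bilinear_def by auto
  note e = linear_componentwise_expansion[OF this(1)] linear_componentwise_expansion[OF this(2)]
  have "b u w = (\<Sum>i\<in>Basis. (u \<bullet> i) *\<^sub>R b i w)" by (rule e)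
  also have "\<dots> = (\<Sum>i\<in>Basis. (u \<bullet> i) *\<^sub>R (\<Sum>j\<in>Basis. (w \<bullet> j) *\<^sub>R b i j))"
    by (intro sum.cong refl arg_cong2[where f = "(*\<^sub>R)"] e)
  finally show ?thesis by (simp add: sum_distrib_left mult.assoc)
qed

section \<open>Calculus of vector fields along an immersion\<close>

context
  fixes A :: "('n::{t2_space,second_countable_topology}, 'f::euclidean_space) chart set"
    and B :: "('m::{t2_space,second_countable_topology}, 'e::euclidean_space) chart set"
    and f :: "'n \<Rightarrow> 'm"
  assumes f: "immersed_submanifold A B f"
begin

lemma manifolds: "smooth_manifold A" "smooth_manifold B" "continuous_on UNIV f"
  using f unfolding immersed_submanifold_def by blast+

lemma smooth_local_map:
  "a \<in> A \<Longrightarrow> b \<in> B \<Longrightarrow> smooth_on (cmap a ` (cdom a \<inter> f -` cdom b)) (cmap b \<circ> f \<circ> cinv a)"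
  using f unfolding immersed_submanifold_def by blast

lemma differentiable_local_map:
  "a \<in> A \<Longrightarrow> b \<in> B \<Longrightarrow> q \<in> cdom a \<Longrightarrow> f q \<in> cdom b \<Longrightarrow>
    (cmap b \<circ> f \<circ> cinv a) differentiable (at (cmap a q))"
  by (rule smooth_on_differentiable[OF smooth_local_map]) auto

lemma linear_tmap: "linear (tmap A B f p)"
  unfolding tmap_def
  by (intro linear_frechet_derivative differentiable_local_map chart_at_mem manifolds)

lemma inj_tmap: "inj (tmap A B f p)"
  using f unfolding immersed_submanifold_def by blast

lemma open_local_domain:
  assumes "a \<in> A" "b \<in> B" "open U"
  shows "open (cmap a ` (cdom a \<inter> f -` cdom b \<inter> U))"
proof -
  have "open (f -` cdom b \<inter> U)"
    using assms open_vimage[OF open_cdom[OF manifolds(2)] manifolds(3)] by blast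
  then show ?thesis using open_chart_image[OF manifolds(1) assms(1)] by (simp add: Int_assoc)
qed

text \<open>Two changes of chart, one on each side of \<open>f\<close>, remove the preferred charts
  at \<open>q\<close> and \<open>f q\<close> and leave the differential of the local expression of
  \<open>f\<close>.\<close>

lemma tcoord_tmap_tvec:
  assumes a: "a \<in> A" and b: "b \<in> B" and q: "q \<in> cdom a" "f q \<in> cdom b"
  shows "tcoord B b (f q) (tmap A B f q (tvec A a q y))
    = frechet_derivative (cmap b \<circ> f \<circ> cinv a) (at (cmap a q)) y"
proof -
  note M = manifolds
  let ?a = "chart_at A q" and ?b = "chart_at B (f q)"
  have 1: "tmap A B f q (tvec A a q y) = frechet_derivative (\<lambda>z. cmap ?b (f (cinv a z))) (at (cmap a q)) y"
    unfolding tmap_def tvec_def comp_def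
    using a q chart_at_mem[OF M(1), of q] chart_at_mem[OF M(2), of "f q"]
      differentiable_local_map[of ?a ?b q]
    by (intro frechet_chart_change[OF M(1)]) (simp_all add: comp_def)
  have "((\<lambda>z. cmap b (f (cinv a z))) has_derivative
    (\<lambda>v. frechet_derivative (\<lambda>w. cmap b (cinv ?b w)) (at (cmap ?b (f q)))
      (frechet_derivative (cmap ?b \<circ> f \<circ> cinv a) (at (cmap a q)) v))) (at (cmap a q))"
    using a b q chart_at_mem[OF M(2), of "f q"] differentiable_transition[OF M(2)]
    by (intro has_derivative_chart_chain[OF M(1,2)] M(3) differentiable_local_map) simp_all
  from fun_cong[OF frechet_derivative_at[OF this], of y] show ?thesis
    unfolding 1 tcoord_def by (simp add: comp_def)
qed

lemma differentiable_along_smooth: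
  assumes V: "smooth_field_along_on A B f U V" and "open U" "p \<in> U"
  shows "differentiable_along_at A B f p V"
proof -
  let ?a = "chart_at A p" and ?b = "chart_at B (f p)"
  have "smooth_on (cmap ?a ` (cdom ?a \<inter> f -` cdom ?b \<inter> U))
      (\<lambda>z. tcoord B ?b (f (cinv ?a z)) (V (cinv ?a z)))"
    using V unfolding smooth_field_along_on_def by (simp add: chart_at_mem manifolds)
  then show ?thesis unfolding differentiable_along_at_def
    by (rule smooth_on_differentiable) (simp add: chart_at_mem manifolds \<open>p \<in> U\<close>)
qed

text \<open>The components of this field are a partial derivative of the local expression of
  \<open>f\<close>, hence smooth.\<close>

lemma differentiable_along_tangent:
  "differentiable_along_at A B f p (\<lambda>q. tmap A B f q (tvec A (chart_at A p) q y))"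
proof -
  note M = manifolds
  let ?a = "chart_at A p" and ?b = "chart_at B (f p)"
  let ?S = "cmap ?a ` (cdom ?a \<inter> f -` cdom ?b \<inter> UNIV)"
  have ab: "?a \<in> A" "?b \<in> B" by (simp_all add: chart_at_mem M)
  have o: "open ?S" using ab by (intro open_local_domain) simp_all
  have "smooth_on ?S (\<lambda>z. frechet_derivative (cmap ?b \<circ> f \<circ> cinv ?a) (at z) y)"
    using smooth_on_frechet_derivative[OF smooth_local_map[OF ab]] by simp
  then have "smooth_on ?S (\<lambda>z. tcoord B ?b (f (cinv ?a z)) (tmap A B f (cinv ?a z) (tvec A ?a (cinv ?a z) y)))"
  proof (rule smooth_on_cong[THEN iffD1, OF o, rotated])
    fix z assume "z \<in> ?S"
    then have "cinv ?a z \<in> cdom ?a" "f (cinv ?a z) \<in> cdom ?b" "cmap ?a (cinv ?a z) = z"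
      using cinv_cmap[OF M(1) ab(1)] by auto
    then show "frechet_derivative (cmap ?b \<circ> f \<circ> cinv ?a) (at z) y
      = tcoord B ?b (f (cinv ?a z)) (tmap A B f (cinv ?a z) (tvec A ?a (cinv ?a z) y))"
      by (simp add: tcoord_tmap_tvec[OF ab])
  qed
  moreover have "cmap ?a p \<in> ?S" by (simp add: chart_at_mem M)
  ultimately show ?thesis
    unfolding differentiable_along_at_def by (rule smooth_on_differentiable)
qed

text \<open>The Leibniz rule along \<open>f\<close>. Both fields are expanded in the coordinate
  frame of one ambient chart; the coefficients of \<beta> in that frame are functions on the ambient
  manifold, and the product rule reassembles into \<open>cov_along\<close>.\<close>

lemma has_derivative_along_2form:
  assumes \<beta>: "parallel_2form B D \<beta>"
    and V: "differentiable_along_at A B f p V" and W: "differentiable_along_at A B f p W"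
  shows "((\<lambda>z. let q = cinv (chart_at A p) z in \<beta> (f q) (V q) (W q)) has_derivative
    (\<lambda>x. \<beta> (f p) (cov_along A B f D p x V) (W p) + \<beta> (f p) (V p) (cov_along A B f D p x W)))
    (at (cmap (chart_at A p) p))"
proof -
  note M = manifolds
  let ?a = "chart_at A p" and ?b = "chart_at B (f p)"
  note a = chart_at_mem[OF M(1), of p] and b = chart_at_mem[OF M(2), of "f p"]
  let ?c = "\<lambda>V z. tcoord B ?b (f (cinv ?a z)) (V (cinv ?a z))"
  let ?d = "\<lambda>V. frechet_derivative (?c V) (at (cmap ?a p))"
  let ?E = "\<lambda>i x. D (f p) (tmap A B f p x) (\<lambda>q. tvec B ?b q i)"
  let ?G = "\<lambda>i j r. \<beta> r (tvec B ?b r i) (tvec B ?b r j)"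
  let ?S = "cmap ?a ` (cdom ?a \<inter> f -` cdom ?b \<inter> UNIV)"
  have bil: "bilinear (\<beta> r)" for r using \<beta> unfolding parallel_2form_def by blast
  have o: "open ?S" using a b by (intro open_local_domain) simp_all
  have pS: "cmap ?a p \<in> ?S" using a b by blast
  have ip: "cinv ?a (cmap ?a p) = p" using cinv_cmap[OF M(1) a] .
  have dV: "(?c V has_derivative ?d V) (at (cmap ?a p))" and dW: "(?c W has_derivative ?d W) (at (cmap ?a p))"
    using V W unfolding differentiable_along_at_def by (simp_all add: frechet_derivative_works[symmetric])
  have cp: "?c V (cmap ?a p) = V p" for V :: "'n \<Rightarrow> 'e"
    by (simp add: ip tcoord_chart_at[OF M(2)])
  \<comment> \<open>Parallelism of \<beta> enters here, for coordinate fields of the ambient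
    manifold; the chain rule then turns the ambient direction into
    \<open>tmap A B f p x\<close>.\<close>
  have dG: "((\<lambda>z. ?G i j (f (cinv ?a z))) has_derivative
      (\<lambda>x. \<beta> (f p) (?E i x) j + \<beta> (f p) i (?E j x))) (at (cmap ?a p))" for i j
  proof -
    have G: "((\<lambda>w. ?G i j (cinv ?b w)) has_derivative
        (\<lambda>v. \<beta> (f p) (D (f p) v (\<lambda>q. tvec B ?b q i)) (tvec B ?b (f p) j)
          + \<beta> (f p) (tvec B ?b (f p) i) (D (f p) v (\<lambda>q. tvec B ?b q j)))) (at (cmap ?b (f p)))"
      using \<beta> smooth_coordinate_field[OF M(2) b(1)] open_cdom[OF M(2) b(1)] b(2)
      unfolding parallel_2form_def by blast
    have "((\<lambda>z. ?G i j (f (cinv ?a z))) has_derivative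
      (\<lambda>v. frechet_derivative (\<lambda>w. ?G i j (cinv ?b w)) (at (cmap ?b (f p)))
        (frechet_derivative (cmap ?b \<circ> f \<circ> cinv ?a) (at (cmap ?a p)) v))) (at (cmap ?a p))"
      using a b G by (intro has_derivative_chart_chain[OF M(1,2)] M(3) differentiable_local_map)
        (auto simp: differentiable_def)
    then show ?thesis
      by (simp add: frechet_derivative_at[OF G, symmetric] tvec_chart_at[OF M(2)] tmap_def)
  qed
  have "((\<lambda>z. \<Sum>i\<in>Basis. \<Sum>j\<in>Basis. (?c V z \<bullet> i) * (?c W z \<bullet> j) * ?G i j (f (cinv ?a z)))
    has_derivative (\<lambda>x. \<Sum>i\<in>Basis. \<Sum>j\<in>Basis.
      (V p \<bullet> i) * (W p \<bullet> j) * (\<beta> (f p) (?E i x) j + \<beta> (f p) i (?E j x))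
      + ((V p \<bullet> i) * (?d W x \<bullet> j) + (?d V x \<bullet> i) * (W p \<bullet> j)) * \<beta> (f p) i j)) (at (cmap ?a p))"
  proof (intro has_derivative_sum)
    fix i j
    have "((\<lambda>z. (?c V z \<bullet> i) * (?c W z \<bullet> j) * ?G i j (f (cinv ?a z))) has_derivative
      (\<lambda>x. (?c V (cmap ?a p) \<bullet> i) * (?c W (cmap ?a p) \<bullet> j) * (\<beta> (f p) (?E i x) j + \<beta> (f p) i (?E j x))
      + ((?c V (cmap ?a p) \<bullet> i) * (?d W x \<bullet> j) + (?d V x \<bullet> i) * (?c W (cmap ?a p) \<bullet> j))
        * ?G i j (f (cinv ?a (cmap ?a p))))) (at (cmap ?a p))"
      by (intro has_derivative_mult has_derivative_inner_left dV dW dG)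
    then show "((\<lambda>z. (?c V z \<bullet> i) * (?c W z \<bullet> j) * ?G i j (f (cinv ?a z))) has_derivative
      (\<lambda>x. (V p \<bullet> i) * (W p \<bullet> j) * (\<beta> (f p) (?E i x) j + \<beta> (f p) i (?E j x))
      + ((V p \<bullet> i) * (?d W x \<bullet> j) + (?d V x \<bullet> i) * (W p \<bullet> j)) * \<beta> (f p) i j)) (at (cmap ?a p))"
      by (simp only: cp ip tvec_chart_at[OF M(2)] tcoord_chart_at[OF M(2)])
  qed
  then have "((\<lambda>z. \<beta> (f (cinv ?a z)) (V (cinv ?a z)) (W (cinv ?a z))) has_derivative (\<lambda>x. \<Sum>i\<in>Basis. \<Sum>j\<in>Basis.
      (V p \<bullet> i) * (W p \<bullet> j) * (\<beta> (f p) (?E i x) j + \<beta> (f p) i (?E j x))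
      + ((V p \<bullet> i) * (?d W x \<bullet> j) + (?d V x \<bullet> i) * (W p \<bullet> j)) * \<beta> (f p) i j)) (at (cmap ?a p))"
    using o pS
  proof (rule has_derivative_transform_within_open)
    fix z assume "z \<in> ?S"
    then have fz: "f (cinv ?a z) \<in> cdom ?b" using cinv_cmap[OF M(1) a(1)] by auto
    define G where "G u w = \<beta> (f (cinv ?a z)) (tvec B ?b (f (cinv ?a z)) u) (tvec B ?b (f (cinv ?a z)) w)"
      for u w
    have "bilinear G"
      using bil[of "f (cinv ?a z)"] linear_tvec[OF M(2) b(1) fz] unfolding bilinear_def G_def
      by (auto intro: linear_compose[unfolded comp_def])
    from linear_double_expansion[OF this, of "?c V z" "?c W z"]
    show "(\<Sum>i\<in>Basis. \<Sum>j\<in>Basis. (?c V z \<bullet> i) * (?c W z \<bullet> j) * ?G i j (f (cinv ?a z)))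
        = \<beta> (f (cinv ?a z)) (V (cinv ?a z)) (W (cinv ?a z))"
      by (simp add: G_def tvec_tcoord[OF M(2) b(1) fz])
  qed
  then show ?thesis unfolding Let_def
  proof (rule has_derivative_eq_rhs, intro ext)
    fix x
    have cov: "cov_along A B f D p x V = ?d V x + (\<Sum>i\<in>Basis. (V p \<bullet> i) *\<^sub>R ?E i x)" for V
      unfolding cov_along_def Let_def ..
    have l: "linear (\<lambda>u. \<beta> (f p) u w)" "linear (\<beta> (f p) u)" for u w
      using bil unfolding bilinear_def by auto
    have r: "\<beta> (f p) u (W p) = (\<Sum>j\<in>Basis. (W p \<bullet> j) * \<beta> (f p) u j)"
      "\<beta> (f p) (V p) u = (\<Sum>i\<in>Basis. (V p \<bullet> i) * \<beta> (f p) i u)" for u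
      unfolding real_scaleR_def[symmetric]
      by (rule linear_componentwise_expansion[OF l(2)], rule linear_componentwise_expansion[OF l(1)])
    have 1: "\<beta> (f p) (cov_along A B f D p x V) (W p) = \<beta> (f p) (?d V x) (W p)
        + (\<Sum>i\<in>Basis. \<Sum>j\<in>Basis. (V p \<bullet> i) * ((W p \<bullet> j) * \<beta> (f p) (?E i x) j))"
      unfolding cov linear_add[OF l(1)] linear_sum[OF l(1)] linear_scale[OF l(1)]
      by (simp only: r(1)[of "?E _ x"] sum_distrib_left real_scaleR_def)
    have 2: "\<beta> (f p) (V p) (cov_along A B f D p x W) = \<beta> (f p) (V p) (?d W x)
        + (\<Sum>i\<in>Basis. \<Sum>j\<in>Basis. (W p \<bullet> j) * ((V p \<bullet> i) * \<beta> (f p) i (?E j x)))"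
      unfolding cov linear_add[OF l(2)] linear_sum[OF l(2)] linear_scale[OF l(2)]
      by (simp only: r(2)[of "?E _ x"] sum_distrib_left real_scaleR_def) (rule arg_cong[OF sum.swap])
    note e = linear_double_expansion[OF bil[of "f p"]]
    have alg: "v * w * (r + s) + (v * w' + v' * w) * t
        = v' * w * t + v * (w * r) + (v * w' * t + w * (v * s))" for v w v' w' r s t :: real
      by (simp add: algebra_simps)
    show "(\<Sum>i\<in>Basis. \<Sum>j\<in>Basis.
      (V p \<bullet> i) * (W p \<bullet> j) * (\<beta> (f p) (?E i x) j + \<beta> (f p) i (?E j x))
      + ((V p \<bullet> i) * (?d W x \<bullet> j) + (?d V x \<bullet> i) * (W p \<bullet> j)) * \<beta> (f p) i j)
      = \<beta> (f p) (cov_along A B f D p x V) (W p) + \<beta> (f p) (V p) (cov_along A B f D p x W)"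
      unfolding 1 2 e[of "?d V x" "W p"] e[of "V p" "?d W x"] sum.distrib[symmetric]
      by (intro sum.cong refl) (rule alg)
  qed
qed

end


section \<open>Parallel tensors of an F0-manifold\<close>

lemma parallel_2formD:
  assumes "parallel_2form B D \<beta>" "open U" "smooth_vector_field_on B U Y" "smooth_vector_field_on B U Z" "r \<in> U"
  shows "((\<lambda>z. \<beta> (cinv (chart_at B r) z) (Y (cinv (chart_at B r) z)) (Z (cinv (chart_at B r) z)))
    has_derivative (\<lambda>v. \<beta> r (D r v Y) (Z r) + \<beta> r (Y r) (D r v Z))) (at (cmap (chart_at B r) r))"
  using assms unfolding parallel_2form_def by blast

text \<open>The compatibility condition in \<open>levi_civita\<close> equates values of
  \<open>frechet_derivative\<close>, which says something about derivatives only for differentiable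
  functions; \<open>diff\<close> supplies that.\<close>

lemma levi_civita_parallel:
  assumes D: "levi_civita B \<beta> D" and bil: "\<And>r. bilinear (\<beta> r)"
    and diff: "\<And>U Y Z r. \<lbrakk>open U; smooth_vector_field_on B U Y; smooth_vector_field_on B U Z; r \<in> U\<rbrakk> \<Longrightarrow>
      (\<lambda>z. \<beta> (cinv (chart_at B r) z) (Y (cinv (chart_at B r) z)) (Z (cinv (chart_at B r) z)))
        differentiable (at (cmap (chart_at B r) r))"
  shows "parallel_2form B D \<beta>"
  unfolding parallel_2form_def
proof (intro conjI allI impI bil)
  fix U Y Z r
  assume *: "open U \<and> smooth_vector_field_on B U Y \<and> smooth_vector_field_on B U Z \<and> r \<in> U"
  let ?F = "\<lambda>z. \<beta> (cinv (chart_at B r) z) (Y (cinv (chart_at B r) z)) (Z (cinv (chart_at B r) z))"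
  have "fun_deriv B (\<lambda>q. \<beta> q (Y q) (Z q)) r v = \<beta> r (D r v Y) (Z r) + \<beta> r (Y r) (D r v Z)" for v
    using D * unfolding levi_civita_def by blast
  then have "(\<lambda>v. \<beta> r (D r v Y) (Z r) + \<beta> r (Y r) (D r v Z)) =
      frechet_derivative ?F (at (cmap (chart_at B r) r))"
    unfolding fun_deriv_def comp_def by fastforce
  moreover have "?F differentiable (at (cmap (chart_at B r) r))"
    using diff * by blast
  ultimately show "(?F has_derivative (\<lambda>v. \<beta> r (D r v Y) (Z r) + \<beta> r (Y r) (D r v Z)))
      (at (cmap (chart_at B r) r))"
    by (simp add: frechet_derivative_works)
qed

text \<open>The difference of two torsion-free metric connections is symmetric in its two arguments and
  skew-symmetric for the metric, hence zero.\<close>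
lemma levi_civita_unique:
  assumes B: "smooth_manifold B"
    and D: "levi_civita B h D" "parallel_2form B D \<beta>"
    and D': "levi_civita B h' D'" "parallel_2form B D' \<beta>"
    and sym: "\<And>u v. \<beta> r u v = \<beta> r v u" and nondeg: "nondegenerate_on (\<beta> r) UNIV"
  shows "D r v (\<lambda>q. tvec B (chart_at B r) q i) = D' r v (\<lambda>q. tvec B (chart_at B r) q i)"
proof -
  let ?b = "chart_at B r"
  let ?X = "\<lambda>i q. tvec B ?b q i"
  let ?G = "\<lambda>v i. D r v (?X i) - D' r v (?X i)"
  note b = chart_at_mem[OF B, of r]
  have U: "open (cdom ?b)" using open_cdom[OF B b(1)] .
  note X = smooth_coordinate_field[OF B b(1)]
  have Xr: "?X i r = i" for i by (rule tvec_chart_at[OF B])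
  \<comment> \<open>Torsion-freeness is taken from the metric that each connection belongs to,
    compatibility from the common form \<beta>. This allows \<open>D\<close> and \<open>D'\<close>
    to be compared although they come from different metrics.\<close>
  have t: "D r (?X i r) (?X j) - D r (?X j r) (?X i) = lie_bracket B (?X i) (?X j) r" for i j
    using D(1) U X b(2) unfolding levi_civita_def by blast
  have t': "D' r (?X i r) (?X j) - D' r (?X j r) (?X i) = lie_bracket B (?X i) (?X j) r" for i j
    using D'(1) U X b(2) unfolding levi_civita_def by blast
  have s: "?G i j = ?G j i" for i j
    using t[of i j] t'[of i j] unfolding Xr by (simp add: algebra_simps)
  have sb: "\<beta> r (?G i j) u = \<beta> r (?G j i) u" for i j u by (simp only: s[of i j])
  have bil: "bilinear (\<beta> r)" using D(2) unfolding parallel_2form_def by blast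
  have k: "\<beta> r (?G v i) j = - \<beta> r (?G v j) i" for v i j
  proof -
    have "(\<lambda>v. \<beta> r (D r v (?X i)) (?X j r) + \<beta> r (?X i r) (D r v (?X j))) =
      (\<lambda>v. \<beta> r (D' r v (?X i)) (?X j r) + \<beta> r (?X i r) (D' r v (?X j)))"
      using parallel_2formD[OF D(2) U X X b(2)] parallel_2formD[OF D'(2) U X X b(2)]
      by (rule has_derivative_unique)
    from fun_cong[OF this, of v] show ?thesis
      unfolding Xr bilinear_lsub[OF bil] by (simp add: sym[of i])
  qed
  \<comment> \<open>Alternating skew-symmetry and symmetry three times each returns to the starting
    expression with the opposite sign.\<close>
  have "\<beta> r (?G v i) j = 0" for j
    using k[of v i j] sb[of v j i] k[of j v i] sb[of j i v] k[of i j v] sb[of i v j] by linarith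
  then have "?G v i = 0" using nondeg unfolding nondegenerate_on_def by blast
  then show ?thesis by simp
qed

section \<open>Algebra of the structure tensors\<close>

context
  fixes B :: "('m::{t2_space,second_countable_topology}, 'e::euclidean_space) chart set"
    and \<phi> :: "'m \<Rightarrow> 'e \<Rightarrow> 'e" and \<xi> :: "'m \<Rightarrow> 'e" and \<eta> :: "'m \<Rightarrow> 'e \<Rightarrow> real"
    and g :: "'m \<Rightarrow> 'e \<Rightarrow> 'e \<Rightarrow> real" and D :: "('m, 'e) connection"
  assumes F0: "F0_manifold B \<phi> \<xi> \<eta> g D"
begin

lemma acm: "almost_contact_B_metric_manifold B \<phi> \<xi> \<eta> g"
  using F0 unfolding F0_manifold_def by blast

lemma
  shows linear_phi: "linear (\<phi> r)" and linear_eta: "linear (\<eta> r)"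
    and phi_phi: "\<phi> r (\<phi> r u) = - u + \<eta> r u *\<^sub>R \<xi> r"
    and eta_xi: "\<eta> r (\<xi> r) = 1"
    and g_phi_phi: "g r (\<phi> r u) (\<phi> r v) = - g r u v + \<eta> r u * \<eta> r v"
  using acm unfolding almost_contact_B_metric_manifold_def by (elim conjE, iprover)+

lemma
  shows bilinear_g: "bilinear (g r)" and g_sym: "g r u v = g r v u"
    and nondegenerate_g: "nondegenerate_on (g r) UNIV"
  using acm unfolding almost_contact_B_metric_manifold_def semi_riemannian_metric_def by (elim conjE, iprover)+

lemma smooth_xi: "smooth_vector_field_on B UNIV \<xi>"
  using acm unfolding almost_contact_B_metric_manifold_def by (elim conjE)

text \<open>The square of \<phi> kills \<xi>, so its cube does too, and the axiom makes \<phi> \<xi>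
  a multiple of \<xi>. Applying \<phi> once more shows that the factor or \<phi> \<xi> itself
  vanishes.\<close>

lemma phi_xi: "\<phi> r (\<xi> r) = 0"
proof -
  have 0: "\<phi> r (\<phi> r (\<xi> r)) = 0" by (simp add: phi_phi eta_xi)
  have "\<phi> r (\<phi> r (\<phi> r (\<xi> r))) = - \<phi> r (\<xi> r) + \<eta> r (\<phi> r (\<xi> r)) *\<^sub>R \<xi> r" by (rule phi_phi)
  then have 1: "\<phi> r (\<xi> r) = \<eta> r (\<phi> r (\<xi> r)) *\<^sub>R \<xi> r"
    by (simp add: 0 linear_0[OF linear_phi])
  from arg_cong[OF this, of "\<phi> r"]
  have "\<phi> r (\<phi> r (\<xi> r)) = \<eta> r (\<phi> r (\<xi> r)) *\<^sub>R \<phi> r (\<xi> r)"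
    by (simp only: linear_scale[OF linear_phi])
  with 0 have "\<eta> r (\<phi> r (\<xi> r)) = 0 \<or> \<phi> r (\<xi> r) = 0" by simp
  with 1 show ?thesis by (metis scaleR_zero_left)
qed

text \<open>The cube of \<phi> is computed by applying the axiom to the outer and to the inner pair
  of factors; the difference is a multiple of \<xi>.\<close>

lemma eta_phi: "\<eta> r (\<phi> r u) = 0"
proof -
  have "\<phi> r (\<phi> r (\<phi> r u)) = - \<phi> r u + \<eta> r (\<phi> r u) *\<^sub>R \<xi> r" by (rule phi_phi)
  moreover have "\<phi> r (\<phi> r (\<phi> r u)) = - \<phi> r u"
    unfolding phi_phi[of r u]
    by (simp only: linear_add[OF linear_phi] linear_neg[OF linear_phi] linear_scale[OF linear_phi]
        phi_xi scaleR_zero_right add_0_right)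
  ultimately have "\<eta> r (\<phi> r u) *\<^sub>R \<xi> r = 0" by simp
  moreover have "\<xi> r \<noteq> 0" using eta_xi[of r] linear_0[OF linear_eta, of r] by force
  ultimately show ?thesis by simp
qed

lemma eta_eq: "\<eta> r u = g r u (\<xi> r)"
  using g_phi_phi[of r u "\<xi> r"] by (simp add: phi_xi eta_xi bilinear_rzero[OF bilinear_g])

text \<open>For a B-metric \<phi> is self-adjoint, unlike the skew-adjoint case of almost contact
  metric structures. Both sides come from evaluating
  \<open>g r (\<phi> r u) (\<phi> r (\<phi> r v))\<close> in two ways.\<close>

lemma g_phi: "g r (\<phi> r u) v = g r u (\<phi> r v)"
proof -
  have "g r (\<phi> r u) (\<phi> r (\<phi> r v)) = - g r u (\<phi> r v)"
    by (simp add: g_phi_phi eta_phi)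
  moreover have "g r (\<phi> r u) (\<phi> r (\<phi> r v)) = - g r (\<phi> r u) v"
    by (simp add: phi_phi bilinear_radd[OF bilinear_g] bilinear_rsub[OF bilinear_g] bilinear_rneg[OF bilinear_g]
        bilinear_rmul[OF bilinear_g] eta_eq[symmetric] eta_phi)
  ultimately show ?thesis by simp
qed

section \<open>Parallelism of the metrics and of the contact form\<close>

lemma parallel_g: "parallel_2form B D g"
proof (rule levi_civita_parallel)
  show "levi_civita B g D" using F0 unfolding F0_manifold_def by blast
  show "bilinear (g r)" for r by (rule bilinear_g)
  fix U Y Z r
  assume *: "open U" "smooth_vector_field_on B U Y" "smooth_vector_field_on B U Z" "r \<in> U"
  have M: "smooth_manifold B" and "semi_riemannian_metric B g"
    using acm unfolding almost_contact_B_metric_manifold_def by blast+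
  then have "smooth_function_on B U (\<lambda>p. g p (Y p) (Z p))"
    using * unfolding semi_riemannian_metric_def by blast
  then have "smooth_on (cmap (chart_at B r) ` (cdom (chart_at B r) \<inter> U))
      (\<lambda>z. g (cinv (chart_at B r) z) (Y (cinv (chart_at B r) z)) (Z (cinv (chart_at B r) z)))"
    unfolding smooth_function_on_def comp_def using chart_at_mem(1)[OF M] by blast
  then show "(\<lambda>z. g (cinv (chart_at B r) z) (Y (cinv (chart_at B r) z)) (Z (cinv (chart_at B r) z)))
      differentiable (at (cmap (chart_at B r) r))"
    using * by (intro smooth_on_differentiable) (auto simp: chart_at_mem[OF M])
qed

lemma smooth_phi:
  "open U \<Longrightarrow> smooth_vector_field_on B U X \<Longrightarrow> smooth_vector_field_on B U (\<lambda>p. \<phi> p (X p))"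
  using acm unfolding almost_contact_B_metric_manifold_def by blast

lemma cov_phi:
  assumes "open U" "smooth_vector_field_on B U Y" "r \<in> U"
  shows "D r v (\<lambda>q. \<phi> q (Y q)) = \<phi> r (D r v Y)"
proof -
  have "\<forall>w. g r (D r v (\<lambda>q. \<phi> q (Y q)) - \<phi> r (D r v Y)) w = 0"
    using F0 assms unfolding F0_manifold_def by blast
  then show ?thesis using nondegenerate_g[of r] unfolding nondegenerate_on_def by auto
qed

lemma parallel_g_phi: "parallel_2form B D (\<lambda>r u v. g r (\<phi> r u) v)"
  unfolding parallel_2form_def
proof (intro conjI allI impI)
  show "bilinear (\<lambda>u. g r (\<phi> r u))" for r
    by (simp add: bilinear_def linear_iff linear_add[OF linear_phi] linear_scale[OF linear_phi]
        bilinear_ladd[OF bilinear_g] bilinear_lmul[OF bilinear_g] bilinear_radd[OF bilinear_g]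
        bilinear_rmul[OF bilinear_g])
next
  fix U Y Z r
  assume *: "open U \<and> smooth_vector_field_on B U Y \<and> smooth_vector_field_on B U Z \<and> r \<in> U"
  then have "D r v (\<lambda>q. \<phi> q (Y q)) = \<phi> r (D r v Y)" for v by (intro cov_phi[of U]) simp_all
  then show "((\<lambda>z. g (cinv (chart_at B r) z) (\<phi> (cinv (chart_at B r) z) (Y (cinv (chart_at B r) z)))
      (Z (cinv (chart_at B r) z))) has_derivative
      (\<lambda>v. g r (\<phi> r (D r v Y)) (Z r) + g r (\<phi> r (Y r)) (D r v Z))) (at (cmap (chart_at B r) r))"
    using parallel_2formD[OF parallel_g, of U "\<lambda>q. \<phi> q (Y q)" Z r] smooth_phi[of U Y] * by simp
qed

text \<open>Differentiating \<phi> \<xi> = 0 puts the derivative of \<xi> into the kernel of \<phi>,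
  the line of \<xi>; the constant length of \<xi> removes that part.\<close>

lemma cov_xi: "D r v \<xi> = 0"
proof -
  note sm = smooth_xi
  have sm0: "smooth_vector_field_on B UNIV (\<lambda>q. \<phi> q (\<xi> q))"
    using sm by (rule smooth_phi[rotated]) simp
  \<comment> \<open>The zero field, written as \<phi> \<xi> to have its smoothness at hand, has
    derivative zero because doubling it changes nothing.\<close>
  have "\<forall>U Y Z. open U \<and> smooth_vector_field_on B U Y \<and> smooth_vector_field_on B U Z \<longrightarrow>
        (\<forall>p\<in>U. \<forall>v. D p v (\<lambda>q. Y q + Z q) = D p v Y + D p v Z)"
    using F0 unfolding F0_manifold_def levi_civita_def affine_connection_def by (elim conjE)
  from this[rule_format, OF conjI[OF open_UNIV conjI[OF sm0 sm0]] UNIV_I, of r v]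
  have "D r v (\<lambda>q. \<phi> q (\<xi> q) + \<phi> q (\<xi> q)) = D r v (\<lambda>q. \<phi> q (\<xi> q)) + D r v (\<lambda>q. \<phi> q (\<xi> q))" .
  then have "D r v (\<lambda>q. \<phi> q (\<xi> q)) = 0" by (simp add: phi_xi)
  then have "\<phi> r (\<phi> r (D r v \<xi>)) = 0"
    using cov_phi[OF open_UNIV sm, of r v] by (simp add: linear_0[OF linear_phi])
  then have 1: "D r v \<xi> = \<eta> r (D r v \<xi>) *\<^sub>R \<xi> r" by (simp add: phi_phi)
  have "((\<lambda>z. 1) has_derivative (\<lambda>v. g r (D r v \<xi>) (\<xi> r) + g r (\<xi> r) (D r v \<xi>)))
      (at (cmap (chart_at B r) r))"
    using parallel_2formD[OF parallel_g open_UNIV sm sm, of r] by (simp add: eta_eq[symmetric] eta_xi)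
  from fun_cong[OF has_derivative_unique[OF this has_derivative_const], of v]
  have 2: "\<eta> r (D r v \<xi>) = 0" by (simp add: eta_eq g_sym[of r "\<xi> r" "D r v \<xi>"])
  show ?thesis using 1[unfolded 2] by simp
qed

text \<open>The one-form \<eta> is the \<open>g\<close>-product with the parallel field \<xi>.
  Taking its tensor square lets \<open>parallel_2form\<close> serve for \<eta> as well.\<close>

lemma parallel_eta_eta: "parallel_2form B D (\<lambda>r u v. \<eta> r u * \<eta> r v)"
  unfolding parallel_2form_def
proof (intro conjI allI impI)
  show "bilinear (\<lambda>u v. \<eta> r u * \<eta> r v)" for r
    by (simp add: bilinear_def linear_iff linear_add[OF linear_eta] linear_scale[OF linear_eta] algebra_simps)
next
  fix U Y Z r
  assume *: "open U \<and> smooth_vector_field_on B U Y \<and> smooth_vector_field_on B U Z \<and> r \<in> U"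
  have M: "smooth_manifold B" using acm unfolding almost_contact_B_metric_manifold_def by blast
  have d: "((\<lambda>z. \<eta> (cinv (chart_at B r) z) (Y (cinv (chart_at B r) z))) has_derivative
      (\<lambda>v. \<eta> r (D r v Y))) (at (cmap (chart_at B r) r))"
    if "smooth_vector_field_on B U Y" for Y
  proof -
    have "smooth_vector_field_on B U \<xi>"
      using smooth_xi unfolding smooth_vector_field_on_def by (blast intro: smooth_on_subset)
    with parallel_2formD[OF parallel_g, of U Y \<xi> r] that * show ?thesis
      by (simp add: eta_eq cov_xi bilinear_rzero[OF bilinear_g])
  qed
  have "smooth_vector_field_on B U Y" "smooth_vector_field_on B U Z" using * by auto
  from has_derivative_mult[OF d[OF this(1)] d[OF this(2)]]
  have "((\<lambda>z. \<eta> (cinv (chart_at B r) z) (Y (cinv (chart_at B r) z)) *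
        \<eta> (cinv (chart_at B r) z) (Z (cinv (chart_at B r) z))) has_derivative
      (\<lambda>v. \<eta> r (Y r) * \<eta> r (D r v Z) + \<eta> r (D r v Y) * \<eta> r (Z r))) (at (cmap (chart_at B r) r))"
    by (simp only: cinv_cmap[OF M chart_at_mem[OF M]])
  then
  show "((\<lambda>z. \<eta> (cinv (chart_at B r) z) (Y (cinv (chart_at B r) z)) *
        \<eta> (cinv (chart_at B r) z) (Z (cinv (chart_at B r) z))) has_derivative
      (\<lambda>v. \<eta> r (D r v Y) * \<eta> r (Z r) + \<eta> r (Y r) * \<eta> r (D r v Z))) (at (cmap (chart_at B r) r))"
    by (simp only: add.commute)
qed

lemma associated_metric_eq: "associated_metric \<phi> \<eta> g r u v = g r (\<phi> r u) v + \<eta> r u * \<eta> r v"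
  by (simp add: associated_metric_def g_phi)

lemma associated_metric_sym: "associated_metric \<phi> \<eta> g r u v = associated_metric \<phi> \<eta> g r v u"
  using g_phi[of r u v] g_sym[of r "\<phi> r u" v] by (simp add: associated_metric_def)

lemma parallel_associated: "parallel_2form B D (associated_metric \<phi> \<eta> g)"
  unfolding parallel_2form_def
proof (intro conjI allI impI)
  fix r
  have "bilinear (\<lambda>u. g r (\<phi> r u))" "bilinear (\<lambda>u v. \<eta> r u * \<eta> r v)"
    using parallel_g_phi parallel_eta_eta unfolding parallel_2form_def by blast+
  then show "bilinear (associated_metric \<phi> \<eta> g r)"
    unfolding bilinear_def associated_metric_eq[abs_def] by (auto intro: linear_compose_add)
next
  fix U Y Z r
  assume "open U \<and> smooth_vector_field_on B U Y \<and> smooth_vector_field_on B U Z \<and> r \<in> U"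
  then show "((\<lambda>z. associated_metric \<phi> \<eta> g (cinv (chart_at B r) z) (Y (cinv (chart_at B r) z))
      (Z (cinv (chart_at B r) z))) has_derivative (\<lambda>v. associated_metric \<phi> \<eta> g r (D r v Y) (Z r)
      + associated_metric \<phi> \<eta> g r (Y r) (D r v Z))) (at (cmap (chart_at B r) r))"
    using has_derivative_add[OF parallel_2formD[OF parallel_g_phi] parallel_2formD[OF parallel_eta_eta],
        of U Y Z r U Y Z]
    unfolding associated_metric_eq by (simp add: algebra_simps)
qed

text \<open>Testing against \<xi> gives \<eta> u = 0; testing against \<phi> v then gives - g u
  v.\<close>

lemma nondegenerate_associated: "nondegenerate_on (associated_metric \<phi> \<eta> g r) UNIV"
  unfolding nondegenerate_on_def
proof (intro ballI impI)
  fix u assume 0: "\<forall>v\<in>UNIV. associated_metric \<phi> \<eta> g r u v = 0"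
  have "\<eta> r u = 0"
    using 0[rule_format, of "\<xi> r"]
    by (simp add: associated_metric_def phi_xi eta_xi bilinear_rzero[OF bilinear_g])
  then have "g r u v = 0" for v
    using 0[rule_format, of "\<phi> r v"] \<open>\<eta> r u = 0\<close>
    by (simp add: associated_metric_def phi_phi bilinear_rsub[OF bilinear_g] bilinear_rmul[OF bilinear_g]
        eta_eq[symmetric])
  then show "u = 0" using nondegenerate_g[of r] unfolding nondegenerate_on_def by blast
qed

text \<open>\<open>cov_along\<close> evaluates the connection only on coordinate fields of the
  preferred chart at \<open>f p\<close>, exactly where uniqueness was shown.\<close>

lemma tangential_cov_associated:
  assumes "levi_civita B (associated_metric \<phi> \<eta> g) D'"
  shows "tangential_cov A B f D' = tangential_cov A B f D"
proof -
  have B: "smooth_manifold B" "levi_civita B g D"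
    using acm F0 unfolding almost_contact_B_metric_manifold_def F0_manifold_def by blast+
  have "parallel_2form B D' (associated_metric \<phi> \<eta> g)"
    using assms
  proof (rule levi_civita_parallel)
    show "bilinear (associated_metric \<phi> \<eta> g r)" for r
      using parallel_associated unfolding parallel_2form_def by blast
  qed (auto dest: parallel_2formD[OF parallel_associated] simp: differentiable_def)
  from levi_civita_unique[OF B parallel_associated assms this associated_metric_sym nondegenerate_associated]
  show ?thesis
    unfolding fun_eq_iff tangential_cov_def cov_along_def Let_def by simp
qed

end


section \<open>Traces with respect to indefinite forms\<close>

text \<open>Gram-Schmidt for indefinite forms: split off a non-null vector, normalized to square 1
  or -1. Its orthogonal complement in \<open>W\<close> has smaller dimension and is again
  non-degenerate.\<close>

lemma orthonormal_basis_exists: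
  fixes b :: "'v::euclidean_space \<Rightarrow> 'v \<Rightarrow> real"
  assumes bil: "bilinear b" and sym: "\<And>u v. b u v = b v u"
    and "subspace W" "nondegenerate_on b W"
  shows "\<exists>E. orthonormal_basis b W E"
  using assms(3,4)
proof (induction "dim W" arbitrary: W rule: less_induct)
  case less
  show ?case
  proof (cases "W = {0}")
    case True
    then have "orthonormal_basis b W {}"
      by (simp add: orthonormal_basis_def independent_empty)
    then show ?thesis by blast
  next
    case False
    \<comment> \<open>By polarization, a symmetric form with only null vectors vanishes on
      \<open>W\<close>.\<close>
    have "\<exists>w\<in>W. b w w \<noteq> 0"
    proof (rule ccontr)
      assume *: "\<not> (\<exists>w\<in>W. b w w \<noteq> 0)"
      have "b u v = 0" if "u \<in> W" "v \<in> W" for u v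
      proof -
        have "b (u + v) (u + v) = 0" "b u u = 0" "b v v = 0"
          using * that subspace_add[OF less.prems(1)] by blast+
        then show ?thesis
          by (simp add: bilinear_ladd[OF bil] bilinear_radd[OF bil] sym[of v u])
      qed
      then have "W \<subseteq> {0}" using less.prems(2) unfolding nondegenerate_on_def by blast
      then show False using False subspace_0[OF less.prems(1)] by blast
    qed
    then obtain w where w: "w \<in> W" "b w w \<noteq> 0" by blast
    define e where "e = (1 / sqrt \<bar>b w w\<bar>) *\<^sub>R w"
    have e: "e \<in> W" unfolding e_def using w(1) less.prems(1) by (simp add: subspace_scale)
    have "b e e = b w w / \<bar>b w w\<bar>"
      unfolding e_def by (simp add: bilinear_lmul[OF bil] bilinear_rmul[OF bil])
    then have be: "\<bar>b e e\<bar> = 1" using w(2) by simp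
    then have be0: "b e e \<noteq> 0" by auto
    define W' where "W' = {v \<in> W. b v e = 0}"
    have W': "subspace W'"
      using less.prems(1) unfolding W'_def subspace_def
      by (simp add: bilinear_ladd[OF bil] bilinear_lmul[OF bil] bilinear_lzero[OF bil])
    have proj: "v - (b v e / b e e) *\<^sub>R e \<in> W'" if "v \<in> W" for v
      using that e be0 less.prems(1) unfolding W'_def
      by (simp add: subspace_diff subspace_scale bilinear_lsub[OF bil] bilinear_lmul[OF bil])
    have "e \<notin> W'" using be0 by (simp add: W'_def)
    then have "W' \<subset> W" using e unfolding W'_def by blast
    then have "dim W' < dim W"
      using W' less.prems(1) by (intro dim_psubset) (simp add: span_eq_iff[THEN iffD2])
    moreover have "nondegenerate_on b W'"
      unfolding nondegenerate_on_def
    proof (intro ballI impI)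
      fix u assume u: "u \<in> W'" "\<forall>v\<in>W'. b u v = 0"
      have "b u v = 0" if "v \<in> W" for v
      proof -
        have "b u (v - (b v e / b e e) *\<^sub>R e) = 0" using u(2) proj[OF that] by blast
        moreover have "b u e = 0" using u(1) by (simp add: W'_def)
        ultimately show ?thesis by (simp add: bilinear_rsub[OF bil] bilinear_rmul[OF bil])
      qed
      then show "u = 0" using u(1) less.prems(2) unfolding nondegenerate_on_def W'_def by blast
    qed
    ultimately obtain E where E: "orthonormal_basis b W' E" using less.hyps W' by blast
    then have sp: "span E = W'" unfolding orthonormal_basis_def by blast
    have EW: "v \<in> W" "b v e = 0" "b e v = 0" if "v \<in> E" for v
      using span_base[OF that] sym[of e v] unfolding sp W'_def by simp_all
    have "span (insert e E) = W"
    proof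
      show "span (insert e E) \<subseteq> W" using e EW less.prems(1) by (intro span_minimal) auto
      show "W \<subseteq> span (insert e E)"
      proof
        fix v assume "v \<in> W"
        then show "v \<in> span (insert e E)"
          unfolding span_insert sp using proj by blast
      qed
    qed
    moreover have "independent (insert e E)"
      using E \<open>e \<notin> W'\<close> sp unfolding orthonormal_basis_def by (simp add: independent_insert)
    ultimately have "orthonormal_basis b W (insert e E)"
      using E be EW unfolding orthonormal_basis_def by auto
    then show ?thesis by blast
  qed
qed

text \<open>The factor \<open>b e e\<close> is a sign and therefore its own inverse.\<close>

lemma orthonormal_expansion:
  fixes b :: "'v::euclidean_space \<Rightarrow> 'v \<Rightarrow> real"
  assumes bil: "bilinear b" and E: "orthonormal_basis b W E" and "w \<in> W"
  shows "w = (\<Sum>e\<in>E. (b e e * b w e) *\<^sub>R e)"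
proof -
  have fin: "finite E" and "w \<in> span E" using E \<open>w \<in> W\<close> unfolding orthonormal_basis_def by blast+
  then obtain c where c: "w = (\<Sum>e\<in>E. c e *\<^sub>R e)" using span_finite[OF fin] by auto
  have "b e e * b w e = c e" if "e \<in> E" for e
  proof -
    have "linear (\<lambda>x. b x e)" using bil unfolding bilinear_def by blast
    note l = linear_sum[OF this] linear_scale[OF this]
    have "b w e = (\<Sum>e'\<in>E. c e' * b e' e)" unfolding c l by simp
    also have "\<dots> = (\<Sum>e'\<in>E. if e' = e then c e * b e e else 0)"
      using E that unfolding orthonormal_basis_def by (intro sum.cong) auto
    also have "\<dots> = c e * b e e" using that fin by simp
    finally have "b e e * b w e = c e * (b e e)\<^sup>2" by (simp add: power2_eq_square)
    moreover have "(b e e)\<^sup>2 = 1"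
      using E that unfolding orthonormal_basis_def by (metis power2_abs one_power2)
    ultimately show ?thesis by simp
  qed
  then show ?thesis using c by simp
qed

text \<open>The trace is computed from any decomposition of the identity in terms of \<open>b\<close>; this replaces
  a change of orthonormal bases.\<close>
lemma trace_decomposition:
  fixes b F :: "'v::euclidean_space \<Rightarrow> 'v \<Rightarrow> real"
  assumes bil: "bilinear b" and F: "bilinear F" and E: "orthonormal_basis b UNIV E" and "finite K"
    and id: "\<And>x. x = b x a0 *\<^sub>R c0 + (\<Sum>k\<in>K. b x (a k) *\<^sub>R c k)"
    and sym: "\<And>u v. b u v = b v u"
  shows "(\<Sum>e\<in>E. b e e * F e e) = F c0 a0 + (\<Sum>k\<in>K. F (c k) (a k))"
proof -
  have Fr: "(\<Sum>e\<in>E. b e e * b e y * F x e) = F x y" for x y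
  proof -
    have "linear (F x)" using F unfolding bilinear_def by blast
    note l = linear_sum[OF this] linear_scale[OF this]
    have "F x y = F x (\<Sum>e\<in>E. (b e e * b y e) *\<^sub>R e)"
      using orthonormal_expansion[OF bil E UNIV_I, of y] by (rule arg_cong)
    then show ?thesis unfolding l by (simp add: sym[of y])
  qed
  have Fl: "F x y = b x a0 * F c0 y + (\<Sum>k\<in>K. b x (a k) * F (c k) y)" for x y
  proof -
    have "linear (\<lambda>x. F x y)" using F unfolding bilinear_def by blast
    note l = linear_sum[OF this] linear_scale[OF this] linear_add[OF this]
    have "F x y = F (b x a0 *\<^sub>R c0 + (\<Sum>k\<in>K. b x (a k) *\<^sub>R c k)) y"
      using id[of x] by (rule arg_cong)
    then show ?thesis unfolding l by simp
  qed
  \<comment> \<open>The decomposition of the identity is inserted into the first slot; the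
    contraction \<open>Fr\<close> then sums out the orthonormal basis in the second.\<close>
  have "b e e * F e e = b e e * b e a0 * F c0 e + (\<Sum>k\<in>K. b e e * b e (a k) * F (c k) e)" for e
    unfolding Fl[of e e] by (simp only: distrib_left sum_distrib_left mult.assoc)
  then have "(\<Sum>e\<in>E. b e e * F e e)
      = (\<Sum>e\<in>E. b e e * b e a0 * F c0 e + (\<Sum>k\<in>K. b e e * b e (a k) * F (c k) e))"
    by (intro sum.cong refl)
  also have "\<dots> = F c0 a0 + (\<Sum>k\<in>K. \<Sum>e\<in>E. b e e * b e (a k) * F (c k) e)"
    by (simp only: sum.distrib Fr sum.swap[of _ K])
  finally show ?thesis by (simp only: Fr)
qed

section \<open>Projections along a subspace\<close>

lemma component_eqI:
  assumes "subspace P" "subspace Q" "P \<inter> Q \<subseteq> {0}" "w \<in> Q" "v - w \<in> P"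
  shows "component P Q v = w"
  unfolding component_def
proof (rule the_equality)
  fix w' assume "w' \<in> Q \<and> v - w' \<in> P"
  then have "(v - w) - (v - w') \<in> P" "w' - w \<in> Q"
    using assms by (blast intro: subspace_diff)+
  then show "w' = w" using assms(3) by auto
qed (use assms in blast)

text \<open>Projecting each term changes the sum only by an element of \<open>P\<close>. The
  criterion does not mention \<open>Q\<close>, so traces formed with different complements of the
  tangent space become comparable.\<close>

lemma trace_component_eq_0_iff:
  assumes P: "subspace P" and Q: "subspace Q" and 0: "P \<inter> Q \<subseteq> {0}"
    and ex: "\<And>v. \<exists>w\<in>Q. v - w \<in> P"
  shows "(\<Sum>e\<in>E. c e *\<^sub>R component P Q (h e)) = 0 \<longleftrightarrow> (\<Sum>e\<in>E. c e *\<^sub>R h e) \<in> P"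
proof -
  have *: "component P Q v \<in> Q" "v - component P Q v \<in> P" for v
  proof -
    obtain w where "w \<in> Q" "v - w \<in> P" using ex by blast
    with component_eqI[OF P Q 0 this] show "component P Q v \<in> Q" "v - component P Q v \<in> P" by auto
  qed
  let ?s = "\<Sum>e\<in>E. c e *\<^sub>R component P Q (h e)" and ?h = "\<Sum>e\<in>E. c e *\<^sub>R h e"
  have Qs: "?s \<in> Q" using * Q by (intro subspace_sum subspace_scale)
  have "(\<Sum>e\<in>E. c e *\<^sub>R (h e - component P Q (h e))) \<in> P"
    using * P by (intro subspace_sum subspace_scale)
  then have Ps: "?h - ?s \<in> P" by (simp add: scaleR_diff_right sum_subtractf)
  show ?thesis
  proof
    assume "?s = 0" then show "?h \<in> P" using Ps by simp
  next
    assume "?h \<in> P"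
    from subspace_diff[OF P this Ps] have "?s \<in> P" by simp
    then show "?s = 0" using Qs 0 by blast
  qed
qed


section \<open>The tangent space at a point\<close>

text \<open>\<open>g\<close>, \<open>\<phi>\<close>, \<open>\<eta>\<close>, \<open>z\<close> are the structure tensors at one point, \<open>z\<close> being the
  Reeb vector, and \<open>t\<close> is the inclusion of the tangent space of the submanifold. The vector \<open>x0\<close>
  spans the radical; \<open>lt\<close> is the lightlike transversal line.\<close>
locale ascreen_point =
  fixes g :: "'e::euclidean_space \<Rightarrow> 'e \<Rightarrow> real" and \<phi> :: "'e \<Rightarrow> 'e" and \<eta> :: "'e \<Rightarrow> real" and z :: 'e
    and t :: "'f::euclidean_space \<Rightarrow> 'e" and S :: "'f set" and x0 :: 'f and lt :: "'e set"
  assumes bil: "bilinear g" and g_sym: "g u v = g v u" and lin_phi: "linear \<phi>"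
    and phi_phi: "\<phi> (\<phi> u) = - u + \<eta> u *\<^sub>R z" and phi_z: "\<phi> z = 0"
    and eta_eq: "\<eta> u = g u z" and eta_phi: "\<eta> (\<phi> u) = 0" and eta_z: "\<eta> z = 1"
    and g_phi: "g (\<phi> u) v = g u (\<phi> v)"
    and lin_t: "linear t" and inj_t: "inj t" and dims: "DIM('e) = DIM('f) + 2"
    and S: "subspace S" "\<exists>\<alpha>. y - \<alpha> *\<^sub>R x0 \<in> S"
    and nondeg_S: "nondegenerate_on (\<lambda>x y. g (t x) (t y)) S"
    and g_x0: "g (t x0) (t y) = 0" and g_L: "g (\<phi> (t x0)) (t y) = 0"
    and L_nonnull: "g (\<phi> (t x0)) (\<phi> (t x0)) \<noteq> 0"
    and lt: "lt = span {N. (\<exists>\<alpha>. g N (t (\<alpha> *\<^sub>R x0)) = 1) \<and> g N N = 0 \<and>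
      (\<forall>l\<in>span {\<phi> (t x0)}. g N l = 0) \<and> (\<forall>x\<in>S. g N (t x) = 0)}"
    and z_lt: "\<exists>\<alpha>. z - \<alpha> *\<^sub>R t x0 \<in> lt"
begin

text \<open>\<open>L\<close> spans the screen transversal line but is not normalized;
  \<open>h\<close> below is the associated metric at the point.\<close>

abbreviation "L \<equiv> \<phi> (t x0)"
abbreviation "b \<equiv> \<eta> (t x0)"
abbreviation "h u v \<equiv> g u (\<phi> v) + \<eta> u * \<eta> v"

lemmas gs = bilinear_ladd[OF bil] bilinear_lsub[OF bil] bilinear_lmul[OF bil] bilinear_lneg[OF bil]
  bilinear_radd[OF bil] bilinear_rsub[OF bil] bilinear_rmul[OF bil] bilinear_rneg[OF bil]
  bilinear_lzero[OF bil] bilinear_rzero[OF bil]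
lemmas phis = linear_add[OF lin_phi] linear_diff[OF lin_phi] linear_scale[OF lin_phi]
  linear_neg[OF lin_phi] linear_0[OF lin_phi]
lemmas ts = linear_add[OF lin_t] linear_diff[OF lin_t] linear_scale[OF lin_t]
  linear_neg[OF lin_t] linear_0[OF lin_t]

lemma linear_g: "linear (\<lambda>u. g u v)" "linear (g u)" using bil unfolding bilinear_def by blast+

lemma linear_eta: "linear \<eta>"
  by (rule linearI) (simp_all add: eta_eq gs)

lemmas etas = linear_add[OF linear_eta] linear_diff[OF linear_eta] linear_scale[OF linear_eta]
  linear_neg[OF linear_eta] linear_0[OF linear_eta]

text \<open>As \<open>t x0\<close> is null, the square of \<phi> contributes only its Reeb term.
  Since \<open>L\<close> is non-null, \<open>b\<close> is non-zero, which justifies the later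
  divisions.\<close>

lemma g_LL: "g L L = b\<^sup>2"
proof -
  have "g L L = g (t x0) (\<phi> L)" by (rule g_phi)
  also have "\<dots> = b * b" unfolding phi_phi by (simp add: gs g_x0 eta_eq)
  finally show ?thesis by (simp add: power2_eq_square)
qed

lemma b_nonzero: "b \<noteq> 0" using L_nonnull g_LL by simp

lemma g_x0': "g (t y) (t x0) = 0" and g_L': "g (t y) L = 0"
  using g_x0 g_L by (simp_all add: g_sym[of "t y"])

lemma lt_orth:
  assumes "l \<in> lt"
  shows "g l L = 0" "x \<in> S \<Longrightarrow> g l (t x) = 0"
proof -
  have *: "g l v = 0" if "v = L \<or> (\<exists>x\<in>S. v = t x)" for v
  proof -
    have "lt \<subseteq> {l. g l v = 0}"
      unfolding lt
    proof (rule span_minimal)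
      show "subspace {l. g l v = 0}" by (simp add: subspace_def gs)
    qed (use that span_base[of L "{L}"] in auto)
    then show ?thesis using assms by blast
  qed
  then show "g l L = 0" "x \<in> S \<Longrightarrow> g l (t x) = 0" by auto
qed

text \<open>The ascreen condition places \<open>z\<close> in the sum of the radical and
  \<open>lt\<close>, both of which are orthogonal to the screen.\<close>

lemma eta_S: "s \<in> S \<Longrightarrow> \<eta> (t s) = 0"
proof -
  assume s: "s \<in> S"
  obtain \<alpha> where "z - \<alpha> *\<^sub>R t x0 \<in> lt" using z_lt by blast
  from lt_orth(2)[OF this s] show "\<eta> (t s) = 0"
    by (simp add: gs g_x0 g_sym[of z] eta_eq)
qed

text \<open>If there were no such vector, \<open>lt\<close> would be zero and \<open>z\<close> a
  non-zero multiple of \<open>t x0\<close>; then \<phi> z = 0 would contradict that \<open>L\<close>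
  is non-null.\<close>

lemma lt_vector:
  obtains N where "N \<in> lt" "g N (t x0) \<noteq> 0" "g N N = 0" "g N L = 0" "\<And>x. x \<in> S \<Longrightarrow> g N (t x) = 0"
proof -
  let ?X = "{N. (\<exists>\<alpha>. g N (t (\<alpha> *\<^sub>R x0)) = 1) \<and> g N N = 0 \<and>
      (\<forall>l\<in>span {L}. g N l = 0) \<and> (\<forall>x\<in>S. g N (t x) = 0)}"
  obtain \<alpha> where \<alpha>: "z - \<alpha> *\<^sub>R t x0 \<in> lt" using z_lt by blast
  have "?X \<noteq> {}"
  proof
    assume "?X = {}"
    then have "lt = {0}" by (simp only: lt span_empty)
    with \<alpha> have "z = \<alpha> *\<^sub>R t x0" by simp
    then have "\<phi> z = \<alpha> *\<^sub>R L" "\<alpha> \<noteq> 0" using eta_z by (auto simp: phis etas)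
    then show False using phi_z L_nonnull by (auto simp: gs)
  qed
  then obtain N where N: "N \<in> ?X" by blast
  then obtain \<beta> where "g N (t (\<beta> *\<^sub>R x0)) = 1" by blast
  then have "g N (t x0) \<noteq> 0" by (auto simp: gs ts)
  with N show ?thesis
    using that[of N] span_base[of L "{L}"] span_base[of N ?X] unfolding lt by blast
qed

text \<open>A dimension count: the plane spanned by \<open>N\<close> and \<open>L\<close> meets the
  right-hand side only in zero, so that space has codimension at least two, while it contains the
  tangent space of codimension two.\<close>

lemma range_t: "range t = {v. g v (t x0) = 0 \<and> g v L = 0}"
proof -
  obtain N where N: "g N (t x0) \<noteq> 0" "g N L = 0" using lt_vector by metis
  let ?K = "{v. g v (t x0) = 0 \<and> g v L = 0}" and ?M = "span {N, L}"
  have K: "subspace ?K" by (simp add: subspace_def gs)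
  have Lx0: "g L (t x0) = 0" by (rule g_L)
  have zero: "\<alpha> = 0 \<and> \<beta> = 0" if "\<alpha> *\<^sub>R N + \<beta> *\<^sub>R L \<in> ?K" for \<alpha> \<beta>
    using that N Lx0 L_nonnull by (simp add: gs)
  have "?K \<inter> ?M = {0}"
  proof -
    have "v = 0" if "v \<in> ?K" "v \<in> ?M" for v
    proof -
      from that(2) obtain \<alpha> where "v - \<alpha> *\<^sub>R N \<in> span {L}" unfolding span_insert[of N] by blast
      then obtain \<beta> where "v - \<alpha> *\<^sub>R N = \<beta> *\<^sub>R L" unfolding span_singleton by blast
      then have "v = \<alpha> *\<^sub>R N + \<beta> *\<^sub>R L" by (simp add: algebra_simps)
      with zero[of \<alpha> \<beta>] that(1) show ?thesis by simp
    qed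
    then show ?thesis using subspace_0[OF K] span_zero by blast
  qed
  then have "dim (?K \<inter> ?M) = 0" by simp
  moreover have "dim ?M = 2"
  proof -
    have "N \<notin> span {L}"
    proof
      assume "N \<in> span {L}"
      then obtain \<beta> where "N = \<beta> *\<^sub>R L" unfolding span_singleton by blast
      then show False using N(1) Lx0 by (simp add: gs)
    qed
    moreover have "L \<noteq> 0" using L_nonnull by (auto simp: gs)
    ultimately have "independent {N, L}" "N \<noteq> L"
      using span_base[of L "{L}"] by (auto simp: independent_insert)
    then show ?thesis by (simp add: dim_eq_card_independent)
  qed
  moreover have "dim {x + y |x y. x \<in> ?K \<and> y \<in> ?M} + dim (?K \<inter> ?M) = dim ?K + dim ?M"
    using K by (intro dim_sums_Int) simp_all
  moreover have "dim {x + y |x y. x \<in> ?K \<and> y \<in> ?M} \<le> DIM('e)" by (rule dim_subset_UNIV)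
  ultimately have "dim ?K \<le> DIM('f)" using dims by linarith
  moreover have "dim (range t) = DIM('f)"
    using dim_image_eq[OF lin_t, of UNIV] inj_t by (simp add: dim_UNIV)
  ultimately have le: "dim ?K \<le> dim (range t)" by simp
  have "range t \<subseteq> ?K" using g_x0' g_L' by auto
  then show ?thesis
    using K le lin_t by (intro subspace_dim_equal) (simp_all add: linear_subspace_image)
qed

lemma subspace_range: "subspace (range t)" using lin_t by (simp add: linear_subspace_image)

text \<open>Self-adjointness makes the image orthogonal to the radical and to \<open>L\<close>,
  hence tangent. A radical part would be seen by \<eta>, which vanishes on images of \<phi>.\<close>

lemma phi_S: "s \<in> S \<Longrightarrow> \<exists>s'\<in>S. \<phi> (t s) = t s'"
proof -
  assume s: "s \<in> S"
  have "g (\<phi> (t s)) (t x0) = 0" unfolding g_phi by (rule g_L')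
  moreover have "g (\<phi> (t s)) L = 0" unfolding g_phi[of "t s" L] phi_phi
    using eta_S[OF s] by (simp add: gs g_x0' eta_eq)
  ultimately obtain y where y: "\<phi> (t s) = t y" using range_t by blast
  obtain \<alpha> where \<alpha>: "y - \<alpha> *\<^sub>R x0 \<in> S" using S(2) by blast
  have "\<eta> (t y) = 0" unfolding y[symmetric] by (rule eta_phi)
  then have "\<alpha> * b = 0" using eta_S[OF \<alpha>] by (simp add: ts etas)
  then show ?thesis using y \<alpha> b_nonzero by auto
qed

definition Phi :: "'f \<Rightarrow> 'f" where "Phi s = (SOME s'. s' \<in> S \<and> \<phi> (t s) = t s')"

lemma Phi: assumes "s \<in> S" shows "Phi s \<in> S" "t (Phi s) = \<phi> (t s)"
proof -
  have "\<exists>s'. s' \<in> S \<and> \<phi> (t s) = t s'" using phi_S[OF assms] by blast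
  from someI_ex[OF this, folded Phi_def] show "Phi s \<in> S" "t (Phi s) = \<phi> (t s)" by simp_all
qed

section \<open>The associated metric and complements of the tangent space\<close>

lemma h_sym: "h u v = h v u"
  using g_phi[of u v] g_sym[of v] by simp

text \<open>Testing against \<open>x0\<close> removes the radical part, as
  \<open>h (t x0) (t x0)\<close> is the square of \<open>b\<close>; testing against
  \<open>Phi s\<close> then recovers the \<open>g\<close>-product with \<open>s\<close> up to
  sign.\<close>

lemma h_nondeg:
  assumes "\<And>x. h (t y) (t x) = 0"
  shows "y = 0"
proof -
  obtain \<alpha> where \<alpha>: "y - \<alpha> *\<^sub>R x0 \<in> S" using S(2) by blast
  have y: "\<eta> (t y) = \<alpha> * b" using eta_S[OF \<alpha>] by (simp add: ts etas)
  have "g (t y) L + \<alpha> * b * b = 0" using assms[of x0] y by simp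
  then have \<alpha>0: "\<alpha> = 0" using g_L' b_nonzero by simp
  then have yS: "y \<in> S" using \<alpha> by simp
  have "g (t y) (t s) = 0" if "s \<in> S" for s
    using assms[of "Phi s"] y \<alpha>0 eta_S[OF that] by (simp add: Phi[OF that] phi_phi gs)
  then show ?thesis using nondeg_S yS unfolding nondegenerate_on_def by blast
qed

text \<open>The tangent space is cut out by two linear functionals, so a pair in \<open>Q\<close>
  dual to them suffices.\<close>

lemma complement:
  assumes "subspace Q" "q1 \<in> Q" "q2 \<in> Q" "g q1 (t x0) = 1" "g q1 L = 0" "g q2 (t x0) = 0" "g q2 L = 1"
  shows "\<exists>w\<in>Q. v - w \<in> range t"
proof
  let ?w = "g v (t x0) *\<^sub>R q1 + g v L *\<^sub>R q2"
  show "?w \<in> Q" using assms by (intro subspace_add subspace_scale)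
  show "v - ?w \<in> range t" unfolding range_t using assms by (simp add: gs)
qed

definition normal_h :: "'e set" where "normal_h = {w. \<forall>y. h w (t y) = 0}"

lemma subspace_normal_h: "subspace normal_h"
  unfolding normal_h_def subspace_def
  by (simp add: gs etas distrib_right add_eq_0_iff mult.assoc flip: distrib_left)

lemma normal_h_Int: "range t \<inter> normal_h \<subseteq> {0}"
proof
  fix v assume "v \<in> range t \<inter> normal_h"
  then obtain y where y: "v = t y" "\<And>x. h (t y) (t x) = 0" unfolding normal_h_def by blast
  from h_nondeg[OF this(2)] show "v \<in> {0}" by (simp add: y(1) ts)
qed

lemma normal_h_complement: "\<exists>w\<in>normal_h. v - w \<in> range t"
proof (rule complement[OF subspace_normal_h])
  have 1: "h w (t y) = g (\<phi> w) (t y) + \<eta> w * \<eta> (t y)" for w y by (simp add: g_phi)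
  \<comment> \<open>The \<open>h\<close>-products of \<open>z\<close>, \<open>t x0\<close> and
    \<open>L\<close> with a tangent vector are 1, \<open>b\<close> and \<open>b\<close> times its
    \<eta>-value, so both differences are normal. The outer factors normalize the dual pair.\<close>
  let ?q1 = "(1 / b) *\<^sub>R (z - (1 / b) *\<^sub>R t x0)" and ?q2 = "(1 / b\<^sup>2) *\<^sub>R (L - t x0)"
  show "?q1 \<in> normal_h" unfolding normal_h_def mem_Collect_eq 1
    using b_nonzero by (simp add: phis gs etas phi_z g_L eta_z)
  show "?q2 \<in> normal_h" unfolding normal_h_def mem_Collect_eq 1
    by (simp add: phis gs etas phi_phi g_L g_x0 eta_phi g_sym[of z] eta_eq[symmetric])
  show "g ?q1 (t x0) = 1" "g ?q1 L = 0"
    using b_nonzero by (simp_all add: gs g_x0 g_L' g_sym[of z] eta_eq[symmetric] eta_phi)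
  show "g ?q2 (t x0) = 0" "g ?q2 L = 1"
    using b_nonzero by (simp_all add: gs g_x0 g_L g_L' g_LL)
qed

text \<open>Suitably scaled, two generators differ by a tangent vector orthogonal to the screen,
  that is by a radical vector. Nullity of both generators makes this difference zero.\<close>

lemma lt_line: "\<exists>N. lt \<subseteq> span {N} \<and> g N (t x0) \<noteq> 0 \<and> g N L = 0"
proof -
  obtain N where N: "N \<in> lt" "g N (t x0) \<noteq> 0" "g N N = 0" "g N L = 0" "\<And>x. x \<in> S \<Longrightarrow> g N (t x) = 0"
    using lt_vector by metis
  have "N' \<in> span {N}"
    if N': "g N' (t (\<alpha> *\<^sub>R x0)) = 1" "g N' N' = 0" "g N' L = 0" "\<And>x. x \<in> S \<Longrightarrow> g N' (t x) = 0" for N' \<alpha>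
  proof -
    let ?c = "g N' (t x0) / g N (t x0)"
    have "N' - ?c *\<^sub>R N \<in> range t" unfolding range_t using N N' by (simp add: gs)
    then obtain y where y: "N' - ?c *\<^sub>R N = t y" by blast
    obtain \<beta> where \<beta>: "y - \<beta> *\<^sub>R x0 \<in> S" using S(2) by blast
    have "g (t (y - \<beta> *\<^sub>R x0)) (t x) = 0" if "x \<in> S" for x
      using N(5)[OF that] N'(4)[OF that] by (simp add: ts gs g_x0 y[symmetric])
    with nondeg_S \<beta> have "y - \<beta> *\<^sub>R x0 = 0" unfolding nondegenerate_on_def by blast
    then have e: "N' = ?c *\<^sub>R N + \<beta> *\<^sub>R t x0" using y by (simp add: ts algebra_simps)
    have "g N' N' = 2 * ?c * \<beta> * g N (t x0)"
      by (subst (1 2) e) (simp add: gs N g_x0 g_sym[of "t x0" N])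
    moreover have "?c * g N (t x0) \<noteq> 0" using N(2) N'(1) by (auto simp: ts gs)
    ultimately have "\<beta> = 0" using N(2) N'(2) by auto
    then show ?thesis using e unfolding span_singleton by auto
  qed
  then have "lt \<subseteq> span {N}"
    unfolding lt using span_base[of L "{L}"] by (intro span_minimal) auto
  then show ?thesis using N by blast
qed

lemma lt_Int: "lt \<inter> span {L} \<subseteq> {0}"
proof
  fix v assume v: "v \<in> lt \<inter> span {L}"
  then obtain \<beta> where "v = \<beta> *\<^sub>R L" unfolding span_singleton by blast
  moreover have "g v L = 0" using lt_orth(1) v by blast
  ultimately show "v \<in> {0}" using L_nonnull by (auto simp: gs)
qed

lemma transversal_Int: "range t \<inter> sum_space lt (span {L}) \<subseteq> {0}"
proof
  fix v assume "v \<in> range t \<inter> sum_space lt (span {L})"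
  then obtain l m where v: "v \<in> range t" "v = l + m" "l \<in> lt" "m \<in> span {L}" unfolding sum_space_def by blast
  obtain \<beta> where m: "m = \<beta> *\<^sub>R L" using v(4) unfolding span_singleton by blast
  obtain N where N: "lt \<subseteq> span {N}" "g N (t x0) \<noteq> 0" "g N L = 0" using lt_line by blast
  then obtain \<alpha> where l: "l = \<alpha> *\<^sub>R N" using v(3) unfolding span_singleton by blast
  have "g v L = 0" "g v (t x0) = 0" using v(1) range_t by auto
  then have "\<alpha> = 0" "\<beta> = 0" using N L_nonnull by (auto simp: v(2) m l gs g_L)
  then show "v \<in> {0}" by (simp add: v(2) l m)
qed

lemma subspace_lt: "subspace lt" unfolding lt by (rule subspace_span)

lemma subspace_transversal: "subspace (sum_space lt (span {L}))"
  unfolding sum_space_def using subspace_lt by (intro subspace_sums) simp_all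

lemma transversal_complement: "\<exists>w\<in>sum_space lt (span {L}). v - w \<in> range t"
proof -
  obtain N where N: "N \<in> lt" "g N (t x0) \<noteq> 0" "g N L = 0" using lt_vector by metis
  show ?thesis
  proof (rule complement[OF subspace_transversal])
    let ?q1 = "(1 / g N (t x0)) *\<^sub>R N" and ?q2 = "(1 / b\<^sup>2) *\<^sub>R L"
    have "?q1 \<in> lt" "?q2 \<in> span {L}" using N subspace_lt by (simp_all add: subspace_scale span_scale span_base)
    then have "?q1 + 0 \<in> sum_space lt (span {L})" "0 + ?q2 \<in> sum_space lt (span {L})"
      unfolding sum_space_def using subspace_0[OF subspace_lt] span_zero by blast+
    then show "?q1 \<in> sum_space lt (span {L})" "?q2 \<in> sum_space lt (span {L})" by simp_all
    show "g ?q1 (t x0) = 1" "g ?q1 L = 0" "g ?q2 (t x0) = 0" "g ?q2 L = 1"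
      using N b_nonzero by (simp_all add: gs g_L g_LL)
  qed
qed

text \<open>\<open>H\<close> is the covariant derivative of tangent fields and \<open>\<Lambda>\<close> that of the section \<open>L\<close>: the normal
  parts of \<open>H\<close> on \<open>S\<close> satisfy \<open>H x (Phi y) = J (H x y)\<close> for a complex structure \<open>J\<close> of the
  quotient by \<open>range t\<close>, so that the two traces correspond to each other under \<open>J\<close>.\<close>
lemma traces_vanish_iff:
  fixes H :: "'f \<Rightarrow> 'f \<Rightarrow> 'e" and \<Lambda> :: "'f \<Rightarrow> 'e"
  assumes lin: "linear \<Lambda>"
    and HL: "\<And>x y. g (H x y) L = - g (\<Lambda> x) (t y)"
    and Hx0: "\<And>x y. g (H x y) (t x0) = g (\<Lambda> x) (\<phi> (t y)) - \<eta> (t y) / b * g (\<Lambda> x) L"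
    and \<Lambda>x0: "\<And>x. g (\<Lambda> x) (t x0) = 0"
  shows "metric_trace (\<lambda>x y. h (t x) (t y)) UNIV (\<lambda>x y. component (range t) normal_h (H x y)) = 0
    \<longleftrightarrow> metric_trace (\<lambda>x y. g (t x) (t y)) S
      (\<lambda>x y. component (range t) (sum_space lt (span {L})) (H x y)) = 0"
proof -
  let ?h = "\<lambda>x y. h (t x) (t y)" and ?g = "\<lambda>x y. g (t x) (t y)"
  note ls = linear_add[OF lin] linear_scale[OF lin]
  have bh: "bilinear ?h" unfolding bilinear_def linear_iff
    by (simp add: gs phis etas ts algebra_simps)
  have bg: "bilinear ?g" unfolding bilinear_def linear_iff
    by (simp add: gs ts)
  define E where "E = (SOME E. orthonormal_basis ?h UNIV E)"
  define K where "K = (SOME E. orthonormal_basis ?g S E)"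
  have "\<exists>E. orthonormal_basis ?h UNIV E"
    using bh h_sym h_nondeg by (intro orthonormal_basis_exists) (auto simp: nondegenerate_on_def)
  then have E: "orthonormal_basis ?h UNIV E" unfolding E_def by (rule someI_ex)
  have "\<exists>E. orthonormal_basis ?g S E"
    using bg g_sym S(1) nondeg_S by (intro orthonormal_basis_exists) blast+
  then have K: "orthonormal_basis ?g S K" unfolding K_def by (rule someI_ex)
  have fin: "finite K" and KS: "\<And>u. u \<in> K \<Longrightarrow> u \<in> S"
    using K span_base unfolding orthonormal_basis_def by blast+
  \<comment> \<open>On the screen, the \<open>h\<close>-product with \<open>a u\<close> is the
    \<open>g\<close>-product with \<open>u\<close>. Hence a \<open>g\<close>-orthonormal basis of
    the screen, completed by \<open>x0\<close> with factor 1 / \<open>b\<^sup>2\<close>, decomposes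
    the identity in terms of \<open>h\<close>.\<close>
  define a where "a u = - Phi u" for u
  define c where "c u = ?g u u *\<^sub>R u" for u
  have ta: "t (a u) = - \<phi> (t u)" if "u \<in> K" for u
    using Phi[OF KS[OF that]] by (simp add: a_def ts)
  have id: "x = ?h x x0 *\<^sub>R ((1 / b\<^sup>2) *\<^sub>R x0) + (\<Sum>u\<in>K. ?h x (a u) *\<^sub>R c u)" for x
  proof -
    obtain \<alpha> where \<alpha>: "x - \<alpha> *\<^sub>R x0 \<in> S" using S(2) by blast
    have "\<eta> (t x) = \<alpha> * b" using eta_S[OF \<alpha>] by (simp add: ts etas)
    then have 1: "?h x x0 = \<alpha> * b\<^sup>2" by (simp add: g_L' power2_eq_square)
    have 2: "?h x (a u) = ?g (x - \<alpha> *\<^sub>R x0) u" if "u \<in> K" for u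
      using eta_S[OF KS[OF that]]
      by (simp add: ta[OF that] phis etas gs ts phi_phi eta_phi g_x0)
    have "x - \<alpha> *\<^sub>R x0 = (\<Sum>u\<in>K. ?h x (a u) *\<^sub>R c u)"
      using orthonormal_expansion[OF bg K \<alpha>] 2 by (simp add: c_def mult.commute)
    then show ?thesis using 1 b_nonzero by (simp add: algebra_simps)
  qed
  define F1 F2 where "F1 x y = g (H x y) (t x0)" and "F2 x y = g (H x y) L" for x y
  have "bilinear F1" unfolding bilinear_def linear_iff F1_def Hx0
    by (simp add: gs phis etas ts ls add_divide_distrib algebra_simps)
  from trace_decomposition[OF bh this E fin id h_sym]
  have T1: "(\<Sum>e\<in>E. ?h e e * F1 e e) = F1 ((1 / b\<^sup>2) *\<^sub>R x0) x0 + (\<Sum>u\<in>K. F1 (c u) (a u))" .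
  have "bilinear F2" unfolding bilinear_def linear_iff F2_def HL
    by (simp add: gs ts ls)
  from trace_decomposition[OF bh this E fin id h_sym]
  have T2: "(\<Sum>e\<in>E. ?h e e * F2 e e) = F2 ((1 / b\<^sup>2) *\<^sub>R x0) x0 + (\<Sum>u\<in>K. F2 (c u) (a u))" .
  \<comment> \<open>Replacing \<open>u\<close> by \<open>a u\<close> in the second slot exchanges
    the products with \<open>t x0\<close> and with \<open>L\<close>; the radical term vanishes
    because the two parts of \<open>Hx0\<close> cancel at \<open>x0\<close>.\<close>
  have T1': "(\<Sum>e\<in>E. ?h e e * F1 e e) = - (\<Sum>u\<in>K. ?g u u * F2 u u)"
  proof -
    have "F1 (c u) (a u) = - (?g u u * F2 u u)" if "u \<in> K" for u
      using eta_S[OF KS[OF that]] unfolding F1_def F2_def Hx0 HL ta[OF that]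
      by (simp add: c_def ls gs phis phi_phi etas eta_phi)
    moreover have "F1 ((1 / b\<^sup>2) *\<^sub>R x0) x0 = 0"
      unfolding F1_def Hx0 using b_nonzero by simp
    ultimately show ?thesis unfolding T1 by (simp add: sum_negf)
  qed
  have T2': "(\<Sum>e\<in>E. ?h e e * F2 e e) = (\<Sum>u\<in>K. ?g u u * F1 u u)"
  proof -
    have "F2 (c u) (a u) = ?g u u * F1 u u" if "u \<in> K" for u
      using eta_S[OF KS[OF that]] unfolding F1_def F2_def Hx0 HL ta[OF that]
      by (simp add: c_def ls gs)
    moreover have "F2 ((1 / b\<^sup>2) *\<^sub>R x0) x0 = 0"
      unfolding F2_def HL by (simp add: \<Lambda>x0)
    ultimately show ?thesis unfolding T2 by simp
  qed
  have mem: "(\<Sum>e\<in>X. d e *\<^sub>R H e e) \<in> range t \<longleftrightarrow>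
      (\<Sum>e\<in>X. d e * F1 e e) = 0 \<and> (\<Sum>e\<in>X. d e * F2 e e) = 0" for X d
    unfolding range_t F1_def F2_def
    by (simp add: linear_sum[OF linear_g(1)] gs)
  have "metric_trace ?h UNIV (\<lambda>x y. component (range t) normal_h (H x y)) = 0 \<longleftrightarrow>
      (\<Sum>e\<in>E. ?h e e *\<^sub>R H e e) \<in> range t"
    unfolding metric_trace_def Let_def E_def[symmetric]
    by (rule trace_component_eq_0_iff[OF subspace_range subspace_normal_h normal_h_Int normal_h_complement])
  also have "\<dots> \<longleftrightarrow> (\<Sum>u\<in>K. ?g u u *\<^sub>R H u u) \<in> range t"
    unfolding mem T1' T2' by auto
  also have "\<dots> \<longleftrightarrow> metric_trace ?g S
      (\<lambda>x y. component (range t) (sum_space lt (span {L})) (H x y)) = 0"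
    unfolding metric_trace_def Let_def K_def[symmetric]
    by (rule trace_component_eq_0_iff[symmetric, OF subspace_range subspace_transversal
          transversal_Int transversal_complement])
  finally show ?thesis .
qed

text \<open>Such a vector is tangent, so its transversal part is already zero. This serves the
  condition on the radical.\<close>

lemma screen_component_zero:
  assumes "g v L = 0" "g v (t x0) = 0"
  shows "component lt (span {L}) (component (range t) (sum_space lt (span {L})) v) = 0"
proof -
  have "component (range t) (sum_space lt (span {L})) v = 0"
    using assms range_t
    by (intro component_eqI[OF subspace_range subspace_transversal transversal_Int])
      (auto simp: subspace_0[OF subspace_transversal])
  moreover have "component lt (span {L}) 0 = 0"
    using lt_Int by (intro component_eqI) (simp_all add: subspace_lt subspace_0 span_zero)
  ultimately show ?thesis by simp
qed

end


section \<open>Equations for the second fundamental form\<close>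

lemma derivative_eq_0_near:
  assumes A: "smooth_manifold A"
    and F: "((\<lambda>z. F (cinv (chart_at A p) z)) has_derivative F') (at (cmap (chart_at A p) p))"
    and "open U" "p \<in> U" "\<And>q. q \<in> U \<Longrightarrow> F q = 0"
  shows "F' x = 0"
proof -
  let ?a = "chart_at A p"
  note a = chart_at_mem[OF A, of p]
  have "((\<lambda>z. 0) has_derivative F') (at (cmap ?a p))"
  proof (rule has_derivative_transform_within_open[OF F open_chart_image[OF A a(1) \<open>open U\<close>]])
    show "cmap ?a p \<in> cmap ?a ` (cdom ?a \<inter> U)" using a(2) \<open>p \<in> U\<close> by blast
    show "F (cinv ?a z) = 0" if "z \<in> cmap ?a ` (cdom ?a \<inter> U)" for z
      using that cinv_cmap[OF A a(1)] assms(5) by auto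
  qed
  from fun_cong[OF has_derivative_unique[OF this has_derivative_const]] show ?thesis .
qed

section \<open>From the immersion to the pointwise model\<close>

context
  fixes A :: "('n::{t2_space,second_countable_topology}, 'f::euclidean_space) chart set"
    and B :: "('m::{t2_space,second_countable_topology}, 'e::euclidean_space) chart set"
    and f :: "'n \<Rightarrow> 'm"
    and \<phi> :: "'m \<Rightarrow> 'e \<Rightarrow> 'e" and \<xi> :: "'m \<Rightarrow> 'e" and \<eta> :: "'m \<Rightarrow> 'e \<Rightarrow> real"
    and g :: "'m \<Rightarrow> 'e \<Rightarrow> 'e \<Rightarrow> real"
    and D :: "('m, 'e) connection"
    and S :: "'n \<Rightarrow> 'f set" and T :: "'n \<Rightarrow> 'e set"
  assumes F0: "F0_manifold B \<phi> \<xi> \<eta> g D"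
    and rst: "radical_screen_transversal A B f \<phi> g S T"
    and asc: "ascreen A B f \<xi> g S T"
begin

lemma half_lightlike: "half_lightlike_submanifold A B f g S T"
  and phi_radical: "\<phi> (f q) ` tmap A B f q ` radical A B f g q = T q"
  using rst unfolding radical_screen_transversal_def by simp_all

lemma immersed: "immersed_submanifold A B f"
  and dim_ambient: "DIM('e) = DIM('f) + 2"
  and dim_radical: "dim (radical A B f g q) = 1"
  and screen_transversal_bundle: "smooth_subbundle (smooth_field_along_on A B f) 1 T"
  and nondegenerate_S: "nondegenerate_on (induced_metric A B f g q) (S q)"
  and nondegenerate_T: "nondegenerate_on (g (f q)) (T q)"
  and sum_tangent: "orthogonal_sum (induced_metric A B f g q) UNIV (radical A B f g q) (S q)"
  and sum_normal: "orthogonal_sum (g (f q)) (normal_space A B f g q) (tmap A B f q ` radical A B f g q) (T q)"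
  using half_lightlike unfolding half_lightlike_submanifold_def by simp_all

lemma T_normal: "l \<in> T q \<Longrightarrow> g (f q) l (tmap A B f q y) = 0"
proof -
  assume l: "l \<in> T q"
  have "0 \<in> tmap A B f q ` radical A B f g q" "normal_space A B f g q = sum_space (tmap A B f q ` radical A B f g q) (T q)"
    using sum_normal[of q] subspace_0 unfolding orthogonal_sum_def by blast+
  then have "0 + l \<in> normal_space A B f g q" using l unfolding sum_space_def by blast
  then show ?thesis by (simp add: normal_space_def)
qed

lemma radical_normal: "x \<in> radical A B f g q \<Longrightarrow> g (f q) (tmap A B f q x) (tmap A B f q y) = 0"
  unfolding radical_def normal_space_def by blast

lemma radical_vector:
  assumes "l \<in> T q" "l \<noteq> 0"
  obtains x where "x \<noteq> 0" "radical A B f g q = span {x}" "\<phi> (f q) (tmap A B f q x) = l"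
proof -
  obtain x where x: "x \<in> radical A B f g q" "\<phi> (f q) (tmap A B f q x) = l"
    using assms(1) unfolding phi_radical[symmetric] by blast
  have "x \<noteq> 0"
    using x(2) assms(2) linear_0[OF linear_tmap[OF immersed, of q]]
      linear_0[OF linear_phi[OF F0, of "f q"]] by auto
  moreover have "radical A B f g q = span {x}"
  proof (rule sym, rule subspace_dim_equal)
    show "subspace (radical A B f g q)" using sum_tangent unfolding orthogonal_sum_def by blast
    then show "span {x} \<subseteq> radical A B f g q" using x(1) by (simp add: span_minimal)
    show "dim (radical A B f g q) \<le> dim (span {x})" using \<open>x \<noteq> 0\<close> dim_radical by simp
  qed simp
  ultimately show ?thesis using that x(2) by blast
qed

text \<open>A local frame of \<open>T\<close> provides \<open>L\<close> near \<open>p\<close>, and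
  \<open>x0\<close> is the radical vector that \<phi> sends to its value at \<open>p\<close>. Only
  \<open>L\<close> is extended to a neighbourhood.\<close>

lemma point_data:
  obtains x0 L U where "ascreen_point (g (f p)) (\<phi> (f p)) (\<eta> (f p)) (\<xi> (f p)) (tmap A B f p) (S p) x0
      (ltr A B f g S T p)"
    and "radical A B f g p = span {x0}" "T p = span {\<phi> (f p) (tmap A B f p x0)}"
    and "open U" "p \<in> U" "\<And>q. q \<in> U \<Longrightarrow> L q \<in> T q" "L p = \<phi> (f p) (tmap A B f p x0)"
    and "differentiable_along_at A B f p L"
proof -
  obtain U X where U: "open U" "p \<in> U" "smooth_field_along_on A B f U ((X :: nat \<Rightarrow> _) 0)"
      "\<And>q. q \<in> U \<Longrightarrow> T q = span {X 0 q}"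
  proof -
    have "\<exists>U X. open U \<and> p \<in> U \<and> (\<forall>i<1. smooth_field_along_on A B f U (X i)) \<and>
        (\<forall>q\<in>U. T q = span ((\<lambda>i. X i q) ` {..<1::nat}))"
      using screen_transversal_bundle unfolding smooth_subbundle_def by blast
    then show ?thesis using that by (auto simp: lessThan_Suc)
  qed
  have "dim (T p) = 1" using screen_transversal_bundle unfolding smooth_subbundle_def by blast
  then have "X 0 p \<noteq> 0" using U(2,4) by auto
  moreover have "X 0 p \<in> T p" using U(2,4) by (simp add: span_base)
  ultimately obtain x0 where x0: "x0 \<noteq> 0" "radical A B f g p = span {x0}"
      "\<phi> (f p) (tmap A B f p x0) = X 0 p"
    using radical_vector by metis
  have Tp: "T p = span {\<phi> (f p) (tmap A B f p x0)}" using U(2,4) x0(3) by simp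
  note bil = bilinear_g[OF F0]
  have x0R: "x0 \<in> radical A B f g p" using x0(2) by (simp add: span_base)
  have LT: "\<phi> (f p) (tmap A B f p x0) \<in> T p" unfolding Tp by (simp add: span_base)
  have nonnull: "g (f p) (\<phi> (f p) (tmap A B f p x0)) (\<phi> (f p) (tmap A B f p x0)) \<noteq> 0"
  proof
    assume 0: "g (f p) (\<phi> (f p) (tmap A B f p x0)) (\<phi> (f p) (tmap A B f p x0)) = 0"
    have "g (f p) (\<phi> (f p) (tmap A B f p x0)) l = 0" if "l \<in> T p" for l
      using that 0 unfolding Tp span_singleton by (auto simp: bilinear_rmul[OF bil])
    then show False
      using nondegenerate_T[of p] LT \<open>X 0 p \<noteq> 0\<close> x0(3) unfolding nondegenerate_on_def by auto
  qed
  have "ascreen_point (g (f p)) (\<phi> (f p)) (\<eta> (f p)) (\<xi> (f p)) (tmap A B f p) (S p) x0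
      (ltr A B f g S T p)"
  proof (rule ascreen_point.intro)
    show "bilinear (g (f p))" by (rule bil)
    show "g (f p) u v = g (f p) v u" for u v by (rule g_sym[OF F0])
    show "linear (\<phi> (f p))" by (rule linear_phi[OF F0])
    show "\<phi> (f p) (\<phi> (f p) u) = - u + \<eta> (f p) u *\<^sub>R \<xi> (f p)" for u by (rule phi_phi[OF F0])
    show "\<phi> (f p) (\<xi> (f p)) = 0" by (rule phi_xi[OF F0])
    show "\<eta> (f p) u = g (f p) u (\<xi> (f p))" for u by (rule eta_eq[OF F0])
    show "\<eta> (f p) (\<phi> (f p) u) = 0" for u by (rule eta_phi[OF F0])
    show "\<eta> (f p) (\<xi> (f p)) = 1" by (rule eta_xi[OF F0])
    show "g (f p) (\<phi> (f p) u) v = g (f p) u (\<phi> (f p) v)" for u v by (rule g_phi[OF F0])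
    show "linear (tmap A B f p)" "inj (tmap A B f p)" using linear_tmap inj_tmap immersed by blast+
    show "DIM('e) = DIM('f) + 2" by (rule dim_ambient)
    show "subspace (S p)" using sum_tangent unfolding orthogonal_sum_def by blast
    show "\<exists>\<alpha>. y - \<alpha> *\<^sub>R x0 \<in> S p" for y
    proof -
      have "y \<in> sum_space (span {x0}) (S p)"
        using sum_tangent[of p] unfolding orthogonal_sum_def x0(2) by blast
      then obtain r s where "y = r + s" "r \<in> span {x0}" "s \<in> S p" unfolding sum_space_def by blast
      then obtain \<alpha> where "r = \<alpha> *\<^sub>R x0" unfolding span_singleton by blast
      then have "y - \<alpha> *\<^sub>R x0 \<in> S p" using \<open>y = r + s\<close> \<open>s \<in> S p\<close> by simp
      then show ?thesis by blast
    qed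
    show "nondegenerate_on (\<lambda>x y. g (f p) (tmap A B f p x) (tmap A B f p y)) (S p)"
      using nondegenerate_S[of p] unfolding induced_metric_def[abs_def] .
    show "g (f p) (tmap A B f p x0) (tmap A B f p y) = 0" for y
      using x0R by (rule radical_normal)
    show "g (f p) (\<phi> (f p) (tmap A B f p x0)) (tmap A B f p y) = 0" for y
      using LT by (rule T_normal)
    show "g (f p) (\<phi> (f p) (tmap A B f p x0)) (\<phi> (f p) (tmap A B f p x0)) \<noteq> 0"
      by (rule nonnull)
    show "ltr A B f g S T p = span {N. (\<exists>\<alpha>. g (f p) N (tmap A B f p (\<alpha> *\<^sub>R x0)) = 1) \<and> g (f p) N N = 0 \<and>
        (\<forall>l\<in>span {\<phi> (f p) (tmap A B f p x0)}. g (f p) N l = 0) \<and>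
        (\<forall>x\<in>S p. g (f p) N (tmap A B f p x) = 0)}"
      unfolding ltr_def Tp x0(2) span_singleton[of x0] by (simp only: bex_simps bex_UNIV image_iff)
    show "\<exists>\<alpha>. \<xi> (f p) - \<alpha> *\<^sub>R tmap A B f p x0 \<in> ltr A B f g S T p"
    proof -
      obtain r l where rl: "\<xi> (f p) = tmap A B f p r + l" "r \<in> span {x0}" "l \<in> ltr A B f g S T p"
        using asc unfolding ascreen_def sum_space_def x0(2)[symmetric] by blast
      then obtain \<alpha> where "r = \<alpha> *\<^sub>R x0" unfolding span_singleton by blast
      then have "\<xi> (f p) - \<alpha> *\<^sub>R tmap A B f p x0 = l"
        using rl(1) by (simp add: linear_scale[OF linear_tmap[OF immersed]])
      then show ?thesis using rl(3) by blast
    qed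
  qed
  moreover have "q \<in> U \<Longrightarrow> X 0 q \<in> T q" for q using U(4) by (simp add: span_base)
  moreover have "differentiable_along_at A B f p (X 0)"
    using differentiable_along_smooth[OF immersed U(3,1,2)] .
  ultimately show ?thesis
    using that[of x0 U "X 0"] x0(2) x0(3)[symmetric] Tp U(1,2) by blast
qed

lemma linear_cov_along:
  assumes "differentiable_along_at A B f p V"
  shows "linear (\<lambda>x. cov_along A B f D p x V)"
proof -
  have M: "smooth_manifold B" using manifolds[OF immersed] by blast
  note b = chart_at_mem[OF M, of "f p"]
  have "\<forall>U Y. open U \<and> smooth_vector_field_on B U Y \<longrightarrow> (\<forall>p\<in>U. linear (\<lambda>v. D p v Y))"
    using F0 unfolding F0_manifold_def levi_civita_def affine_connection_def by (elim conjE)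
  then have "linear (\<lambda>v. D (f p) v (\<lambda>q. tvec B (chart_at B (f p)) q i))" for i
    using open_cdom[OF M b(1)] smooth_coordinate_field[OF M b(1)] b(2) by blast
  from linear_compose[OF linear_tmap[OF immersed] this, unfolded comp_def]
  have "linear (\<lambda>x. D (f p) (tmap A B f p x) (\<lambda>q. tvec B (chart_at B (f p)) q i))" for i .
  then show ?thesis
    unfolding cov_along_def Let_def
    using assms unfolding differentiable_along_at_def
    by (intro linear_compose_add linear_compose_sum linear_compose_scale_right ballI linear_frechet_derivative)
qed

text \<open>The condition on the radical always holds here, so the two traces remain to be
  compared.\<close>

lemma minimal_at_iff:
  "metric_trace (induced_metric A B f (associated_metric \<phi> \<eta> g) p) UNIV
      (normal_second_form A B f (associated_metric \<phi> \<eta> g) D p) = 0 \<longleftrightarrow>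
    (\<forall>x\<in>radical A B f g p. screen_second_form A B f g D S T p x x = 0) \<and>
    metric_trace (induced_metric A B f g p) (S p) (transversal_second_form A B f g D S T p) = 0"
proof -
  obtain x0 L U where pt: "ascreen_point (g (f p)) (\<phi> (f p)) (\<eta> (f p)) (\<xi> (f p)) (tmap A B f p) (S p) x0
      (ltr A B f g S T p)"
    and Rad: "radical A B f g p = span {x0}" and Tp: "T p = span {\<phi> (f p) (tmap A B f p x0)}"
    and U: "open U" "p \<in> U" and LT: "\<And>q. q \<in> U \<Longrightarrow> L q \<in> T q"
    and Lp: "L p = \<phi> (f p) (tmap A B f p x0)"
    and dL: "differentiable_along_at A B f p L"
    by (rule point_data[of p], rule that, assumption+)
  interpret P: ascreen_point "g (f p)" "\<phi> (f p)" "\<eta> (f p)" "\<xi> (f p)" "tmap A B f p" "S p" x0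
    "ltr A B f g S T p" by (rule pt)
  note M = manifolds[OF immersed]
  let ?t = "tmap A B f p"
  let ?b = "\<eta> (f p) (?t x0)"
  define \<Lambda> where "\<Lambda> x = cov_along A B f D p x L" for x
  define H where "H x y = tangential_cov A B f D p x y" for x y
  define Y where "Y y q = tmap A B f q (tvec A (chart_at A p) q y)" for y q
  have dY: "differentiable_along_at A B f p (Y y)" for y
    unfolding Y_def[abs_def] by (rule differentiable_along_tangent[OF immersed])
  have Yp: "Y y p = ?t y" for y by (simp add: Y_def tvec_chart_at[OF M(1)])
  have covY: "cov_along A B f D p x (Y y) = H x y" for x y
    unfolding H_def tangential_cov_def Y_def[abs_def] ..
  note der = has_derivative_along_2form[OF immersed, unfolded Let_def]
  note zero = derivative_eq_0_near[OF M(1) _ U]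
  have gLY: "g (f q) (L q) (Y y q) = 0" if qU: "q \<in> U" for q y
    unfolding Y_def by (rule T_normal[OF LT[OF qU]])
  \<comment> \<open>The radical vector \<open>v\<close> is chosen separately at each point and
    disappears from every identity that is differentiated.\<close>
  have Lq: "\<exists>v. L q = \<phi> (f q) v \<and> g (f q) v v = 0 \<and> g (f q) v (L q) = 0 \<and> (\<forall>y. g (f q) v (Y y q) = 0)"
    if qU: "q \<in> U" for q
  proof -
    obtain r where r: "r \<in> radical A B f g q" "L q = \<phi> (f q) (tmap A B f q r)"
      using LT[OF qU] unfolding phi_radical[symmetric] by blast
    then show ?thesis
      using radical_normal[OF r(1)] T_normal[OF LT[OF qU], of r]
      by (intro exI[of _ "tmap A B f q r"]) (simp add: Y_def g_phi[OF F0, symmetric])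
  qed
  have gpLY: "g (f q) (\<phi> (f q) (L q)) (Y y q) = \<eta> (f q) v * \<eta> (f q) (Y y q)"
    if "L q = \<phi> (f q) v" "g (f q) v (Y y q) = 0" for q y v
    using that(2)
    by (simp add: that(1) phi_phi[OF F0] bilinear_lsub[OF bilinear_g[OF F0]] bilinear_ladd[OF bilinear_g[OF F0]]
        bilinear_lneg[OF bilinear_g[OF F0]] bilinear_lmul[OF bilinear_g[OF F0]]
        g_sym[OF F0, of _ "\<xi> (f q)"] eta_eq[OF F0])
  have etaL: "\<eta> (f q) (L q) = 0" if qU: "q \<in> U" for q
    using Lq[OF qU] eta_phi[OF F0] by auto
  have gLL: "g (f q) (L q) (L q) = \<eta> (f q) v * \<eta> (f q) v"
    if "L q = \<phi> (f q) v" "g (f q) v v = 0" for q v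
    using that by (simp add: g_phi_phi[OF F0])
  have gpLL: "g (f q) (\<phi> (f q) (L q)) (L q) = 0" if qU: "q \<in> U" for q
  proof -
    obtain v where v: "L q = \<phi> (f q) v" "g (f q) v (L q) = 0" using Lq[OF qU] by blast
    have "g (f q) (\<phi> (f q) (\<phi> (f q) v)) (L q) = \<eta> (f q) v * g (f q) (\<xi> (f q)) (L q)"
      using v(2)
      by (simp add: phi_phi[OF F0] bilinear_lsub[OF bilinear_g[OF F0]] bilinear_ladd[OF bilinear_g[OF F0]]
        bilinear_lneg[OF bilinear_g[OF F0]] bilinear_lmul[OF bilinear_g[OF F0]])
    also have "g (f q) (\<xi> (f q)) (L q) = 0"
      using etaL[OF qU] by (simp add: eta_eq[OF F0] g_sym[OF F0, of _ "\<xi> (f q)"])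
    finally show ?thesis by (simp add: v(1)[symmetric])
  qed
  have E1: "g (f p) (\<Lambda> x) (?t y) + g (f p) (L p) (H x y) = 0" for x y
    using zero[OF der[OF parallel_g[OF F0] dL dY[of y]] gLY, of x]
    unfolding covY Yp \<Lambda>_def .
  have E2: "g (f p) (\<phi> (f p) (\<Lambda> x)) (L p) + g (f p) (\<phi> (f p) (L p)) (\<Lambda> x) = 0" for x
    using zero[OF der[OF parallel_g_phi[OF F0] dL dL] gpLL, of x]
    unfolding \<Lambda>_def .
  have E3: "\<eta> (f p) (\<Lambda> x) * ?b + \<eta> (f p) (L p) * \<eta> (f p) (H x x0) = 0" for x
    using zero[OF der[OF parallel_eta_eta[OF F0] dL dY[of x0]], of x]
    unfolding covY Yp \<Lambda>_def by (simp add: etaL)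
  \<comment> \<open>Each first factor is \<eta> v times an \<eta>-value, and \<open>g L L\<close> is
    the square of \<eta> v. The product of two such factors thus eliminates the unknown \<eta>
    v.\<close>
  have prod: "g (f q) (\<phi> (f q) (L q)) (Y y q) * g (f q) (\<phi> (f q) (L q)) (Y w q)
      - g (f q) (L q) (L q) * (\<eta> (f q) (Y y q) * \<eta> (f q) (Y w q)) = 0" if qU: "q \<in> U" for q y w
  proof -
    obtain v where v: "L q = \<phi> (f q) v" "g (f q) v v = 0" "\<And>y. g (f q) v (Y y q) = 0"
      using Lq[OF qU] by blast
    show ?thesis unfolding gpLY[OF v(1,3)] gLL[OF v(1,2)] by simp
  qed
  have ip: "cinv (chart_at A p) (cmap (chart_at A p) p) = p"
    using cinv_cmap[OF M(1) chart_at_mem[OF M(1)]] .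
  have E4: "g (f p) (\<phi> (f p) (L p)) (?t y)
        * (g (f p) (\<phi> (f p) (\<Lambda> x)) (?t w) + g (f p) (\<phi> (f p) (L p)) (H x w))
      + (g (f p) (\<phi> (f p) (\<Lambda> x)) (?t y) + g (f p) (\<phi> (f p) (L p)) (H x y))
        * g (f p) (\<phi> (f p) (L p)) (?t w)
      - (g (f p) (L p) (L p) * (\<eta> (f p) (H x y) * \<eta> (f p) (?t w) + \<eta> (f p) (?t y) * \<eta> (f p) (H x w))
        + (g (f p) (\<Lambda> x) (L p) + g (f p) (L p) (\<Lambda> x)) * (\<eta> (f p) (?t y) * \<eta> (f p) (?t w))) = 0"
    for x y w
    using zero[OF has_derivative_diff[OF
        has_derivative_mult[OF der[OF parallel_g_phi[OF F0] dL dY[of y]] der[OF parallel_g_phi[OF F0] dL dY[of w]]]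
        has_derivative_mult[OF der[OF parallel_g[OF F0] dL dL] der[OF parallel_eta_eta[OF F0] dY[of y] dY[of w]]]]
        prod, of x]
    unfolding covY Yp ip \<Lambda>_def .
  have pL: "\<phi> (f p) (L p) = - ?t x0 + ?b *\<^sub>R \<xi> (f p)" unfolding Lp by (rule phi_phi[OF F0])
  have gpL: "g (f p) (\<phi> (f p) (L p)) u = - g (f p) (?t x0) u + ?b * \<eta> (f p) u" for u
    unfolding pL by (simp add: P.gs P.g_sym[of "\<xi> (f p)"] P.eta_eq)
  have b0: "?b \<noteq> 0" by (rule P.b_nonzero)
  have LL: "g (f p) (L p) (L p) = ?b * ?b" unfolding Lp using P.g_LL by (simp add: power2_eq_square)
  have eL: "\<eta> (f p) (\<Lambda> x) = 0" for x
    using E3[of x] b0 etaL[OF U(2)] by simp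
  \<comment> \<open>The two summands of \<open>E2\<close> agree because \<phi> is self-adjoint.
    Since \<phi> L = - x0 + b \<xi> and \<eta> kills \<Lambda>, what remains is the product with
    \<open>x0\<close>.\<close>
  have \<Lambda>x0: "g (f p) (\<Lambda> x) (?t x0) = 0" for x
  proof -
    have "g (f p) (\<phi> (f p) (\<Lambda> x)) (L p) = g (f p) (\<phi> (f p) (L p)) (\<Lambda> x)"
      unfolding P.g_phi[of "\<Lambda> x"] by (rule P.g_sym)
    with E2[of x] have "g (f p) (\<phi> (f p) (L p)) (\<Lambda> x) = 0" by simp
    then show ?thesis unfolding gpL by (simp add: eL P.g_sym[of "\<Lambda> x"])
  qed
  have pLx0: "g (f p) (\<phi> (f p) (\<Lambda> x)) (?t x0) = g (f p) (\<Lambda> x) (L p)" for x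
    unfolding P.g_phi Lp ..
  \<comment> \<open>With both tangent fields through \<open>x0\<close> in \<open>E4\<close>, the
    terms in g \<Lambda> L and in \<eta> H cancel.\<close>
  have Hx0x0: "g (f p) (?t x0) (H x x0) = 0" for x
  proof -
    have "2 * (?b * ?b) * g (f p) (?t x0) (H x x0) = 0"
      using E4[of x0 x x0] unfolding gpL pLx0 LL P.g_x0 P.g_sym[of "L p" "\<Lambda> x"]
      by (simp add: algebra_simps)
    then show ?thesis using b0 by simp
  qed
  have Hx0: "g (f p) (H x y) (?t x0)
      = g (f p) (\<Lambda> x) (\<phi> (f p) (?t y)) - \<eta> (f p) (?t y) / ?b * g (f p) (\<Lambda> x) (L p)" for x y
  proof -
    \<comment> \<open>Now only the second field of \<open>E4\<close> passes through
      \<open>x0\<close>; its own contribution is known from \<open>Hx0x0\<close>, and the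
      \<eta>-values of \<open>H\<close> cancel again.\<close>
    have "?b * (?b * (g (f p) (\<Lambda> x) (\<phi> (f p) (?t y)) - g (f p) (?t x0) (H x y))
        - \<eta> (f p) (?t y) * g (f p) (\<Lambda> x) (L p)) = 0"
      using E4[of y x x0]
      unfolding gpL pLx0 LL P.g_x0 P.g_sym[of "L p" "\<Lambda> x"] Hx0x0 P.g_phi[of "\<Lambda> x" "?t y"]
      by (simp add: algebra_simps)
    then have "?b * (g (f p) (\<Lambda> x) (\<phi> (f p) (?t y)) - g (f p) (?t x0) (H x y))
        - \<eta> (f p) (?t y) * g (f p) (\<Lambda> x) (L p) = 0"
      using b0 by simp
    then show ?thesis using b0 by (simp add: P.g_sym[of "H x y"] field_simps)
  qed
  have HL: "g (f p) (H x y) (L p) = - g (f p) (\<Lambda> x) (?t y)" for x y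
    using E1[of x y] by (simp add: P.g_sym[of "H x y"])
  have lin: "linear \<Lambda>" unfolding \<Lambda>_def by (rule linear_cov_along[OF dL])
  have e1: "induced_metric A B f (associated_metric \<phi> \<eta> g) p
      = (\<lambda>x y. g (f p) (?t x) (\<phi> (f p) (?t y)) + \<eta> (f p) (?t x) * \<eta> (f p) (?t y))"
    unfolding induced_metric_def associated_metric_def fun_eq_iff by blast
  have e2: "normal_second_form A B f (associated_metric \<phi> \<eta> g) D p
      = (\<lambda>x y. component (range ?t) P.normal_h (H x y))"
    unfolding normal_second_form_def P.normal_h_def H_def normal_space_def associated_metric_def fun_eq_iff
    by blast
  have e3: "induced_metric A B f g p = (\<lambda>x y. g (f p) (?t x) (?t y))"
    unfolding induced_metric_def fun_eq_iff by blast
  have e4: "transversal_second_form A B f g D S T p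
      = (\<lambda>x y. component (range ?t) (sum_space (ltr A B f g S T p) (span {\<phi> (f p) (?t x0)})) (H x y))"
    unfolding transversal_second_form_def H_def Tp fun_eq_iff by blast
  have "screen_second_form A B f g D S T p x x = 0" if "x \<in> radical A B f g p" for x
  proof -
    obtain \<alpha> where x: "x = \<alpha> *\<^sub>R x0" using \<open>x \<in> radical A B f g p\<close> unfolding Rad span_singleton by blast
    have "g (f p) (H x x) (L p) = 0"
      unfolding HL by (simp add: x P.ts P.gs \<Lambda>x0)
    moreover have "g (f p) (H x x) (?t x0) = 0"
      unfolding Hx0 using b0 by (simp add: x P.ts P.phis P.etas P.gs Lp)
    ultimately show ?thesis
      unfolding screen_second_form_def e4 Tp by (intro P.screen_component_zero) (simp_all add: Lp)
  qed
  moreover note P.traces_vanish_iff[OF lin HL[unfolded Lp] Hx0[unfolded Lp] \<Lambda>x0]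
  ultimately show ?thesis unfolding e1 e2 e3 e4 by blast
qed

end

section \<open>Equivalence of the two minimality conditions\<close>

theorem theorem1p2:
  fixes A :: "('n::{t2_space,second_countable_topology}, 'f::euclidean_space) chart set"
    and B :: "('m::{t2_space,second_countable_topology}, 'e::euclidean_space) chart set"
    and f :: "'n \<Rightarrow> 'm"
    and \<phi> :: "'m \<Rightarrow> 'e \<Rightarrow> 'e" and \<xi> :: "'m \<Rightarrow> 'e" and \<eta> :: "'m \<Rightarrow> 'e \<Rightarrow> real"
    and g :: "'m \<Rightarrow> 'e \<Rightarrow> 'e \<Rightarrow> real"
    and D D' :: "('m, 'e) connection"
    and S :: "'n \<Rightarrow> 'f set" and T :: "'n \<Rightarrow> 'e set"
    and n :: nat
  assumes "DIM('e) = 2 * n + 1"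
    and "F0_manifold B \<phi> \<xi> \<eta> g D"
    and "levi_civita B (associated_metric \<phi> \<eta> g) D'"
    and "radical_screen_transversal A B f \<phi> g S T"
    and "ascreen A B f \<xi> g S T"
  shows "minimal_semi_riemannian A B f (associated_metric \<phi> \<eta> g) D' \<longleftrightarrow>
         minimal_half_lightlike A B f g D S T"
proof -
  have "normal_second_form A B f (associated_metric \<phi> \<eta> g) D'
      = normal_second_form A B f (associated_metric \<phi> \<eta> g) D"
    unfolding normal_second_form_def[abs_def] tangential_cov_associated[OF assms(2,3)] ..
  then show ?thesis
    unfolding minimal_semi_riemannian_def minimal_half_lightlike_def
    by (simp only: minimal_at_iff[OF assms(2,4,5)])
qed

end
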